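(* Let $N\in\{2,3\}$ and let $p>1$ be a real number. Set \[ c_p=\left(\frac{p+1}{2}\right)^{\frac{1}{p-1}},\qquad w_0(t)=c_p\left[\cosh\left(\frac{p-1}{2}t\right)\right]^{-\frac{2}{p-1}},\quad t\in\mathbb{R}. \] Then the only positive bounded solution $v$ of the half-space Dirichlet problem \[ \left\{\begin{array}{l} -\Delta v+v=|v|^{p-1}v \quad \text{in } \mathbb{R}^N_+,\\ v=c_p \quad \text{on } \partial\mathbb{R}^N_+,\\ \lim_{x_N\to\infty}v(x',x_N)=0 \quad \text{uniformly in } x'\in\mathbb{R}^{N-1}, \end{array}\right. \] is $v(x)=w_0(x_N)$, $x=(x',x_N)\in\overline{\mathbb{R}^N_+}$.
   Context: Points of $\mathbb{R}^N$ are written $x=(x',x_N)$ with $x'\in\mathbb{R}^{N-1}$ and $x_N\in\mathbb{R}$; $\mathbb{R}^N_+=\{x\in\mathbb{R}^N : x_N>0\}$ is the open half-space and $\partial\mathbb{R}^N_+=\{x_N=0\}$ is its boundary. Solutions are understood in the classical sense: $v\in C^2(\mathbb{R}^N_+)\cap C(\overline{\mathbb{R}^N_+})$ satisfying the equation pointwise in $\mathbb{R}^N_+$ and the boundary condition pointwise. Positive means $v>0$ in $\mathbb{R}^N_+$; bounded means $\sup_{\mathbb{R}^N_+}|v|<\infty$. The uniform limit means: for every $\varepsilon>0$ there is $L>0$ such that $|v(x',x_N)|<\varepsilon$ for all $x'\in\mathbb{R}^{N-1}$ and all $x_N>L$. *)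

theory Defs
  imports "HOL-Analysis.Analysis"
begin

text \<open>
  A point of \<open>\<real>\<^sup>N\<close> is a pair \<open>(x', x\<^sub>N)\<close> of type \<open>(real ^ 'm) \<times> real\<close>, where \<open>'m\<close> indexes
  the \<open>N - 1\<close> tangential coordinates. The product type carries the Euclidean inner product, and its
  \<open>DIM\<close> is \<open>N = CARD('m) + 1\<close>.
\<close>

definition half_space :: "((real ^ 'm) \<times> real) set" where
  "half_space = {x. snd x > 0}"

lemma open_half_space: "open half_space"
  unfolding half_space_def by (intro open_Collect_less continuous_intros)

lemma closure_half_space: "closure half_space = {x. snd x \<ge> 0}"
proof -
  have "closure {x. ((0, 1) :: (real ^ 'm) \<times> real) \<bullet> x > 0} = {x. (0, 1) \<bullet> x \<ge> 0}"
    by (rule closure_halfspace_gt) (simp add: prod_eq_iff)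
  then show ?thesis
    by (simp add: half_space_def inner_prod_def)
qed

lemma frontier_half_space: "frontier half_space = {x. snd x = 0}"
  by (auto simp: frontier_def closure_half_space interior_open[OF open_half_space])
    (auto simp: half_space_def)

definition partial_deriv :: "'a::euclidean_space \<Rightarrow> ('a \<Rightarrow> real) \<Rightarrow> 'a \<Rightarrow> real" where
  "partial_deriv i f x = deriv (\<lambda>t. f (x + t *\<^sub>R i)) 0"

text \<open>
  The classes \<open>C\<^sup>1(S)\<close> and \<open>C\<^sup>2(S)\<close> for open \<open>S\<close>. The values of \<open>f\<close> outside \<open>S\<close> play no role, because
  the derivatives at a point of an open \<open>S\<close> depend only on the values of \<open>f\<close> on \<open>S\<close>.
\<close>

definition C1_on :: "('a::euclidean_space \<Rightarrow> real) \<Rightarrow> 'a set \<Rightarrow> bool" where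
  "C1_on f S \<longleftrightarrow> f differentiable_on S \<and> (\<forall>i\<in>Basis. continuous_on S (partial_deriv i f))"

definition C2_on :: "('a::euclidean_space \<Rightarrow> real) \<Rightarrow> 'a set \<Rightarrow> bool" where
  "C2_on f S \<longleftrightarrow> C1_on f S \<and> (\<forall>i\<in>Basis. C1_on (partial_deriv i f) S)"

definition laplacian :: "('a::euclidean_space \<Rightarrow> real) \<Rightarrow> 'a \<Rightarrow> real" where
  "laplacian f x = (\<Sum>i\<in>Basis. partial_deriv i (partial_deriv i f) x)"

definition c_const :: "real \<Rightarrow> real" where
  "c_const p = ((p + 1) / 2) powr (1 / (p - 1))"

definition w0 :: "real \<Rightarrow> real \<Rightarrow> real" where
  "w0 p t = c_const p * cosh ((p - 1) / 2 * t) powr (- 2 / (p - 1))"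

text \<open>
  Classical solutions of the half-space Dirichlet problem. A function on the closed half-space is
  represented by a total function of which only the values on the closed half-space matter.
\<close>

definition dirichlet_solution :: "real \<Rightarrow> ((real ^ 'm) \<times> real \<Rightarrow> real) \<Rightarrow> bool" where
  "dirichlet_solution p v \<longleftrightarrow>
     C2_on v half_space \<and>
     continuous_on (closure half_space) v \<and>
     (\<forall>x\<in>half_space. - laplacian v x + v x = \<bar>v x\<bar> powr (p - 1) * v x) \<and>
     (\<forall>x\<in>frontier half_space. v x = c_const p) \<and>
     uniform_limit UNIV (\<lambda>t x'. v (x', t)) (\<lambda>x'. 0) at_top"

definition positive_bounded_solution :: "real \<Rightarrow> ((real ^ 'm) \<times> real \<Rightarrow> real) \<Rightarrow> bool" where
  "positive_bounded_solution p v \<longleftrightarrow>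
     dirichlet_solution p v \<and> (\<forall>x\<in>half_space. v x > 0) \<and> bounded (v ` half_space)"

end

theory Submission
  imports Defs
begin

text \<open>
  Let \<open>\<psi> = - w\<^sub>0'\<close>, which is positive for \<open>t > 0\<close>. Differentiating \<open>w\<^sub>0'' = w\<^sub>0 - w\<^sub>0\<^sup>p\<close> gives \<open>\<psi>'' = - q \<psi>\<close> with
  \<open>q = p w\<^sub>0\<^sup>p\<^sup>-\<^sup>1 - 1\<close>, and the boundary value \<open>c\<^sub>p\<close> is exactly the maximum of \<open>w\<^sub>0\<close>, so that
  \<open>\<psi>(0) = 0\<close>: the linearisation of the one-dimensional problem at \<open>w\<^sub>0\<close> has a positive kernel element
  that satisfies the Dirichlet condition. For a solution \<open>v\<close> put \<open>\<phi> = v - w\<^sub>0(x\<^sub>N)\<close> and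
  \<open>g = v\<^sup>p - w\<^sub>0\<^sup>p - p w\<^sub>0\<^sup>p\<^sup>-\<^sup>1 \<phi>\<close>, which is nonnegative by convexity of \<open>r \<mapsto> r\<^sup>p\<close> and vanishes only
  where \<open>v = w\<^sub>0\<close>. Then \<open>- \<Delta>\<phi> = q \<phi> + g\<close>, and integrating twice by parts in \<open>x\<^sub>N\<close> shows that
  \<open>\<Phi>(x') = \<integral> v(x', t) \<psi>(t) dt\<close> (over \<open>t > 0\<close>) satisfies \<open>\<Delta>' \<Phi> = - \<integral> g \<psi> dt \<le> 0\<close>. So \<open>\<Phi>\<close> is a bounded
  superharmonic function on \<open>\<real>\<^sup>N\<^sup>-\<^sup>1\<close>. Since \<open>N - 1 \<le> 2\<close>, it is constant by Liouville's theorem for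
  superharmonic functions, whence \<open>g = 0\<close> and \<open>v = w\<^sub>0\<close>. In dimension \<open>N - 1 \<ge> 3\<close> this last step
  breaks down, because there bounded nonconstant superharmonic functions exist.

  The solution is only continuous at the boundary, and the hypotheses contain no bound on its
  derivatives, there or at infinity. Therefore the argument is carried out in weak form
  (\<open>tested_equation\<close>): the equation is tested with \<open>\<eta>(x') \<psi>(t) \<chi>(t)\<close>, where \<open>\<eta>\<close> and \<open>\<chi>\<close> are
  twice continuously differentiable cutoffs and the product has compact support in the open half-space,
  and all derivatives are moved to the test function. Two terms have to be controlled.

  The tangential term carries \<open>\<Delta>' \<eta>\<close>. With the logarithmic cutoff
  \<open>\<eta> = (1 - ln (1 + |x'|\<^sup>2) / n)\<^sub>+\<^sup>3\<close> one has \<open>\<Delta>' \<eta> \<ge> - (12 / n) (1 + |x'|\<^sup>2)\<^sup>-\<^sup>2\<close> in dimension at most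
  two (\<open>tangential_cutoff_laplacian_ge\<close>). A lower bound is enough because \<open>v > 0\<close>, and the right-hand
  side is integrable over \<open>\<real>\<^sup>N\<^sup>-\<^sup>1\<close>, so the term is \<open>O(1/n)\<close>.

  The normal term carries \<open>2 \<psi>' \<chi>' + \<psi> \<chi>''\<close>. With \<open>\<chi> = (1 - \<delta> (t + 1/t))\<^sub>+\<^sup>3\<close> it is bounded by a
  multiple of \<open>\<delta> (1 + 1/t\<^sup>2)\<close> on \<open>[\<delta>, 1/\<delta>]\<close> (\<open>cutoff_error_bound\<close>; this uses \<open>\<psi>(t) = O(t)\<close>). The integral
  of \<open>\<delta> (1 + 1/t\<^sup>2)\<close> over \<open>[\<delta>, 1/\<delta>]\<close> stays below \<open>2\<close> as \<open>\<delta> \<rightarrow> 0\<close> while its mass moves to \<open>t = 0\<close> and \<open>t = \<infinity>\<close>, and there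
  \<open>\<phi>\<close> is small by the boundary condition and by the decay of \<open>v\<close>
  (\<open>difference_small_outside_strip\<close>).
\<close>

section \<open>Directional derivatives and integration by parts\<close>

abbreviation has_dir_deriv :: "('a::real_normed_vector \<Rightarrow> real) \<Rightarrow> 'a \<Rightarrow> real \<Rightarrow> 'a \<Rightarrow> bool" where
  "has_dir_deriv f i D x \<equiv> ((\<lambda>s. f (x + s *\<^sub>R i)) has_real_derivative D) (at 0)"

lemma has_dir_deriv_along:
  assumes "has_dir_deriv f i D (x + s *\<^sub>R i)"
  shows "((\<lambda>s. f (x + s *\<^sub>R i)) has_real_derivative D) (at s)"
proof -
  have "((\<lambda>u. f (x + s *\<^sub>R i + (u - s) *\<^sub>R i)) has_real_derivative D * 1) (at s)"
    by (rule DERIV_chain2[where g = "\<lambda>u. u - s"]) (use assms in \<open>auto intro!: derivative_eq_intros\<close>)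
  then show ?thesis by (simp add: algebra_simps)
qed

text \<open>
  The integral of \<open>(h(x + e i) - h(x)) / e\<close> vanishes for every \<open>e \<noteq> 0\<close>, by translation invariance of
  Lebesgue measure, and dominated convergence passes to the limit \<open>e \<rightarrow> 0\<close>. This gives integration by
  parts in any direction without iterated integrals.
\<close>

lemma has_integral_dir_deriv_0:
  fixes h D :: "'a::euclidean_space \<Rightarrow> real"
  assumes S: "open S" and K: "compact K" "K \<subseteq> S"
    and h: "continuous_on S h" and D: "continuous_on S D"
    and deriv: "\<And>x. x \<in> S \<Longrightarrow> has_dir_deriv h i (D x) x"
    and supp: "\<And>x. x \<in> S - K \<Longrightarrow> h x = 0"
  shows "has_bochner_integral lborel (\<lambda>x. indicator K x *\<^sub>R D x) 0"
proof -
  \<comment> \<open>Extended by zero, \<open>h\<close> and \<open>D\<close> are continuous on the whole space, and the derivative relation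
  persists.\<close>
  define h0 where "h0 = (\<lambda>x. if x \<in> K then h x else 0)"
  define D0 where "D0 = (\<lambda>x. if x \<in> K then D x else 0)"
  have opK: "open (- K)" using K by (simp add: compact_imp_closed open_Compl)
  have UN: "S \<union> - K = UNIV" using K by auto
  have h0S: "h0 x = h x" if "x \<in> S" for x using that supp by (auto simp: h0_def)
  have ev: "\<forall>\<^sub>F s in nhds 0. x + s *\<^sub>R i \<in> U" if "open U" "x \<in> U" for U x
  proof -
    have "filterlim (\<lambda>s. x + s *\<^sub>R i) (nhds (x + 0 *\<^sub>R i)) (nhds 0)"
      by (intro tendsto_intros filterlim_ident)
    then show ?thesis using topological_tendstoD[OF _ that(1)] that(2) by simp
  qed
  have off: "has_dir_deriv h0 i 0 x" if "x \<notin> K" for x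
  proof -
    have "\<forall>\<^sub>F s in nhds 0. h0 (x + s *\<^sub>R i) = 0"
      using ev[OF opK, of x] that by (auto elim!: eventually_mono simp: h0_def)
    from DERIV_cong_ev[OF refl this refl] show ?thesis by simp
  qed
  have on: "has_dir_deriv h0 i (D x) x" if "x \<in> S" for x
  proof -
    have "\<forall>\<^sub>F s in nhds 0. h0 (x + s *\<^sub>R i) = h (x + s *\<^sub>R i)"
      using ev[OF S that] by (auto elim!: eventually_mono simp: h0S)
    from DERIV_cong_ev[OF refl this refl] show ?thesis using deriv[OF that] by simp
  qed
  have D0S: "D0 x = D x" if "x \<in> S" for x
    using DERIV_unique[OF on[OF that] off] by (auto simp: D0_def)
  have der: "has_dir_deriv h0 i (D0 x) x" for x
    using on[of x] off[of x] K by (cases "x \<in> K") (auto simp: D0_def)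
  have "continuous_on (S \<union> - K) h0"
  proof (intro continuous_on_open_Un S opK)
    show "continuous_on S h0" by (rule continuous_on_eq[OF h]) (simp add: h0S)
    show "continuous_on (- K) h0" by (rule continuous_on_eq[of _ "\<lambda>_. 0"]) (auto simp: h0_def)
  qed
  then have ch: "continuous_on UNIV h0" by (simp add: UN)
  have "continuous_on (S \<union> - K) D0"
  proof (intro continuous_on_open_Un S opK)
    show "continuous_on S D0" by (rule continuous_on_eq[OF D]) (simp add: D0S)
    show "continuous_on (- K) D0" by (rule continuous_on_eq[of _ "\<lambda>_. 0"]) (auto simp: D0_def)
  qed
  then have cD: "continuous_on UNIV D0" by (simp add: UN)
  obtain B where B: "\<And>x. \<bar>D0 x\<bar> \<le> B"
  proof -
    have "compact (D0 ` K)"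
      using K cD by (intro compact_continuous_image) (auto intro: continuous_on_subset)
    then have "bounded (D0 ` K)" by (rule compact_imp_bounded)
    then obtain B where B: "\<forall>y\<in>D0 ` K. \<bar>y\<bar> \<le> B" by (auto simp: bounded_real)
    have "\<bar>D0 x\<bar> \<le> max 0 B" for x using B by (cases "x \<in> K") (auto simp: D0_def le_max_iff_disj)
    then show ?thesis using that by blast
  qed
  have "(\<lambda>x. indicator K x *\<^sub>R h0 x) = h0" by (auto simp: h0_def indicator_def)
  then have h0_int: "integrable lborel h0"
    using borel_integrable_compact[OF K(1) continuous_on_subset[OF ch]] by simp
  have h0_shift: "integrable lborel (\<lambda>x. h0 (x + c))"
    "(LINT x|lborel. h0 (x + c)) = (LINT x|lborel. h0 x)" for c
    using h0_int integrable_distr_eq[of "(+) c" lborel borel h0]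
      integral_distr[of "(+) c" lborel borel h0] borel_measurable_integrable[OF h0_int]
    by (simp_all add: lborel_distr_plus add.commute)
  \<comment> \<open>The difference quotients with step at most one live on this enlargement of \<open>K\<close>.\<close>
  define K1 where "K1 = (\<lambda>(x, s). x - s *\<^sub>R i) ` (K \<times> {0..1::real})"
  have K1: "compact K1" unfolding K1_def
    by (intro compact_continuous_image compact_Times K)
       (auto simp: case_prod_unfold intro!: continuous_intros)
  define q where "q = (\<lambda>n x. (h0 (x + (1 / real (Suc n)) *\<^sub>R i) - h0 x) * real (Suc n))"
  have bound: "norm (q n x) \<le> indicator K1 x * B" for n x
  proof -
    define e where "e = 1 / real (Suc n)"
    have e: "0 < e" "e \<le> 1" by (auto simp: e_def)
    have "\<exists>s>0. s < e \<and> h0 (x + e *\<^sub>R i) - h0 (x + 0 *\<^sub>R i) = (e - 0) * D0 (x + s *\<^sub>R i)"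
      by (rule MVT2[OF e(1)]) (rule has_dir_deriv_along[OF der])
    then obtain s where s: "0 < s" "s < e" "h0 (x + e *\<^sub>R i) - h0 x = e * D0 (x + s *\<^sub>R i)"
      by auto
    have q: "q n x = D0 (x + s *\<^sub>R i)" using s(3) by (simp add: q_def e_def)
    show ?thesis
    proof (cases "x + s *\<^sub>R i \<in> K")
      case True
      then have "x \<in> K1" unfolding K1_def using s e
        by (intro image_eqI[of _ _ "(x + s *\<^sub>R i, s)"]) auto
      then show ?thesis using q B by simp
    next
      case False
      have "0 \<le> B" using B[of x] by linarith
      then show ?thesis using q False by (simp add: D0_def)
    qed
  qed
  have lim: "(\<lambda>n. q n x) \<longlonglongrightarrow> D0 x" for x
  proof -
    have "((\<lambda>s. (h0 (x + s *\<^sub>R i) - h0 x) / s) \<longlongrightarrow> D0 x) (at 0)"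
      using der[of x] by (simp add: has_field_derivative_iff)
    moreover have "filterlim (\<lambda>n. 1 / real (Suc n)) (at 0) sequentially"
      by (intro filterlim_atI LIMSEQ_Suc[OF lim_1_over_n]) auto
    ultimately have "(\<lambda>n. (h0 (x + (1 / real (Suc n)) *\<^sub>R i) - h0 x) / (1 / real (Suc n))) \<longlonglongrightarrow> D0 x"
      by (rule filterlim_compose)
    then show ?thesis by (simp add: q_def)
  qed
  have "(\<lambda>n. LINT x|lborel. q n x) \<longlonglongrightarrow> (LINT x|lborel. D0 x)"
  proof (rule integral_dominated_convergence[where w = "\<lambda>x. indicator K1 x * B"])
    show "D0 \<in> borel_measurable lborel" using cD by (simp add: borel_measurable_continuous_onI)
    have "h0 \<in> borel_measurable borel" using ch by (simp add: borel_measurable_continuous_onI)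
    then show "q n \<in> borel_measurable lborel" for n unfolding q_def by measurable
    show "integrable lborel (\<lambda>x. indicator K1 x * B)"
      using borel_integrable_compact[OF K1, of "\<lambda>_. B"] by simp
  qed (use lim bound in auto)
  moreover have "(LINT x|lborel. q n x) = 0" for n
    unfolding q_def using h0_shift[of "(1 / real (Suc n)) *\<^sub>R i"] h0_int by simp
  ultimately have "(LINT x|lborel. D0 x) = 0"
    using LIMSEQ_unique[of "\<lambda>_. 0::real"] by simp
  moreover have "(\<lambda>x. indicator K x *\<^sub>R D x) = D0" by (auto simp: D0_def indicator_def)
  moreover have "integrable lborel D0"
    using borel_integrable_compact[OF K(1) continuous_on_subset[OF D K(2)]] calculation(2) by simp
  ultimately show ?thesis by (simp add: has_bochner_integral_iff)
qed

lemma C1_on_dir_deriv: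
  assumes "open S" "C1_on f S" "x \<in> S" "i \<in> Basis"
  shows "has_dir_deriv f i (partial_deriv i f x) x"
proof -
  have "f differentiable at x"
    using assms by (auto simp: C1_on_def differentiable_on_def at_within_open[of x S])
  then have "f differentiable at (x + 0 *\<^sub>R i)" by simp
  then have "(\<lambda>s. f (x + s *\<^sub>R i)) differentiable at 0"
    by (rule differentiable_compose) (auto intro!: derivative_intros)
  then show ?thesis
    unfolding partial_deriv_def using DERIV_deriv_iff_real_differentiable by blast
qed

text \<open>
  The second Green identity in one direction. The function \<open>f z' - z \<partial>\<^sub>i f\<close> has directional
  derivative \<open>f z'' - z \<partial>\<^sub>i \<partial>\<^sub>i f\<close> because the mixed terms cancel.
\<close>

lemma green_identity:
  fixes f z z' z'' :: "'a::euclidean_space \<Rightarrow> real"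
  assumes S: "open S" and K: "compact K" "K \<subseteq> S" and i: "i \<in> Basis" and f: "C2_on f S"
    and cont: "continuous_on S z" "continuous_on S z'" "continuous_on S z''"
    and z': "\<And>x. x \<in> S \<Longrightarrow> has_dir_deriv z i (z' x) x"
    and z'': "\<And>x. x \<in> S \<Longrightarrow> has_dir_deriv z' i (z'' x) x"
    and supp: "\<And>x. x \<in> S - K \<Longrightarrow> z x = 0" "\<And>x. x \<in> S - K \<Longrightarrow> z' x = 0"
  shows "has_bochner_integral lborel
    (\<lambda>x. indicator K x *\<^sub>R (f x * z'' x - z x * partial_deriv i (partial_deriv i f) x)) 0"
proof -
  have C1: "C1_on f S" "C1_on (partial_deriv i f) S"
    using f i by (auto simp: C2_on_def)
  have cf: "continuous_on S f" "continuous_on S (partial_deriv i f)"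
    "continuous_on S (partial_deriv i (partial_deriv i f))"
    using C1 i by (auto simp: C1_on_def intro: differentiable_imp_continuous_on)
  show ?thesis
  proof (rule has_integral_dir_deriv_0[OF S K,
      where h = "\<lambda>x. f x * z' x - z x * partial_deriv i f x"])
    fix x assume x: "x \<in> S"
    show "has_dir_deriv (\<lambda>x. f x * z' x - z x * partial_deriv i f x) i
       (f x * z'' x - z x * partial_deriv i (partial_deriv i f) x) x"
      by (rule derivative_eq_intros C1_on_dir_deriv[OF S C1(1) x i] C1_on_dir_deriv[OF S C1(2) x i]
        z'[OF x] z''[OF x] refl)+ simp
  qed (use supp in \<open>auto intro!: continuous_intros cont cf\<close>)
qed

text \<open>
  Cubes of positive parts serve below as twice continuously differentiable cutoffs.
\<close>

lemma DERIV_pos_part_power: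
  fixes s :: real
  assumes "0 < k"
  shows "((\<lambda>s. max 0 s ^ Suc k) has_real_derivative real (Suc k) * max 0 s ^ k) (at s)"
proof -
  consider "s > 0" | "s < 0" | "s = 0" by linarith
  then show ?thesis
  proof cases
    case 1
    have "\<forall>\<^sub>F x in nhds s. max 0 x ^ Suc k = x ^ Suc k"
      using eventually_nhds_in_open[of "{0<..}" s] 1 by (auto elim!: eventually_mono)
    from DERIV_cong_ev[OF refl this refl] show ?thesis using 1
      by (auto intro!: derivative_eq_intros simp del: power_Suc)
  next
    case 2
    have "\<forall>\<^sub>F x in nhds s. max 0 x ^ Suc k = 0"
      using eventually_nhds_in_open[of "{..<0}" s] 2 by (auto elim!: eventually_mono)
    from DERIV_cong_ev[OF refl this refl] show ?thesis using 2 assms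
      by (auto intro!: derivative_eq_intros simp del: power_Suc simp: max_def)
  next
    case 3
    have "((\<lambda>h. max 0 h ^ Suc k / h) \<longlongrightarrow> 0) (at (0::real))"
    proof (rule Lim_null_comparison)
      show "((\<lambda>h::real. \<bar>h\<bar> ^ k) \<longlongrightarrow> 0) (at 0)"
        using assms by (auto intro!: tendsto_eq_intros)
      show "\<forall>\<^sub>F h in at (0::real). norm (max 0 h ^ Suc k / h) \<le> \<bar>h\<bar> ^ k"
        by (intro always_eventually) (auto simp: max_def)
    qed
    then show ?thesis using 3 assms by (simp add: has_field_derivative_iff power_0_left)
  qed
qed

section \<open>The one-dimensional profile\<close>

lemma c_const_pos: "p > 1 \<Longrightarrow> c_const p > 0"
  by (simp add: c_const_def)

lemma w0_pos: "p > 1 \<Longrightarrow> w0 p t > 0"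
  by (simp add: w0_def c_const_pos cosh_real_nonzero)

lemma w0_0: "w0 p 0 = c_const p"
  by (simp add: w0_def)

lemma w0_le: assumes "p > 1" shows "w0 p t \<le> c_const p"
proof -
  have "cosh ((p - 1) / 2 * t) powr (- 2 / (p - 1)) \<le> 1 powr (- 2 / (p - 1))"
    using assms by (intro powr_mono2') (auto simp: cosh_real_ge_1)
  then show ?thesis using c_const_pos[OF assms] by (simp add: w0_def mult_left_le)
qed

lemma w0_powr_minus_1:
  assumes "p > 1"
  shows "w0 p t powr (p - 1) = (p + 1) / 2 / (cosh ((p - 1) / 2 * t))\<^sup>2"
proof -
  have "- 2 / (p - 1) * (p - 1) = -2" "1 / (p - 1) * (p - 1) = 1" using assms by (auto simp: field_simps)
  then have "w0 p t powr (p - 1) = ((p + 1) / 2) powr 1 * cosh ((p - 1) / 2 * t) powr - 2"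
    unfolding w0_def c_const_def using assms by (subst powr_mult) (auto simp: powr_powr)
  also have "cosh ((p - 1) / 2 * t) powr - 2 = 1 / (cosh ((p - 1) / 2 * t))\<^sup>2"
    by (simp add: powr_minus_divide cosh_real_nonneg)
  finally show ?thesis using assms by simp
qed

text \<open>
  This is the function \<open>\<psi> = - w\<^sub>0'\<close>, in the form that shows its sign and its zero at \<open>0\<close>.
\<close>

definition w0_slope :: "real \<Rightarrow> real \<Rightarrow> real" where
  "w0_slope p t = w0 p t * tanh ((p - 1) / 2 * t)"

lemma DERIV_w0:
  assumes "p > 1"
  shows "(w0 p has_real_derivative - w0_slope p t) (at t)"
proof -
  define b where "b = (p - 1) / 2"
  have b: "b > 0" "- 2 / (p - 1) = - 1 / b" using assms by (auto simp: b_def)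
  have w: "w0 p = (\<lambda>t. c_const p * cosh (b * t) powr (- 1 / b))"
    by (intro ext) (simp only: w0_def b(2) b_def[symmetric])
  have "((\<lambda>t. c_const p * cosh (b * t) powr (- 1 / b)) has_real_derivative
      c_const p * (- 1 / b * cosh (b * t) powr (- 1 / b - 1) * (sinh (b * t) * b))) (at t)"
    by (rule derivative_eq_intros DERIV_cmult refl
      | simp add: cosh_real_pos)+
  moreover have "cosh (b * t) powr (- 1 / b - 1) = cosh (b * t) powr (- 1 / b) / cosh (b * t)"
    by (subst powr_diff) (simp add: cosh_real_nonneg)
  ultimately show ?thesis using b(1) by (simp add: w w0_slope_def tanh_def b_def[symmetric] mult.assoc)
qed

lemma DERIV_w0_slope:
  assumes "p > 1"
  shows "(w0_slope p has_real_derivative w0 p t powr p - w0 p t) (at t)"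
proof -
  define b where "b = (p - 1) / 2"
  define T where "T = tanh (b * t)"
  have C: "1 - T\<^sup>2 = 1 / (cosh (b * t))\<^sup>2"
  proof -
    have "1 - T\<^sup>2 = ((cosh (b * t))\<^sup>2 - (sinh (b * t))\<^sup>2) / (cosh (b * t))\<^sup>2"
      by (simp add: T_def tanh_def power_divide diff_divide_distrib)
    then show ?thesis by (simp only: hyperbolic_pythagoras)
  qed
  have d: "(w0_slope p has_real_derivative - w0_slope p t * T + w0 p t * ((1 - T\<^sup>2) * b)) (at t)"
    unfolding w0_slope_def[abs_def] b_def[symmetric] T_def
    by (rule derivative_eq_intros DERIV_w0[OF assms] refl | simp add: cosh_real_nonzero w0_slope_def b_def)+
  have "w0 p t powr p = w0 p t * w0 p t powr (p - 1)"
    using powr_add[of "w0 p t" 1 "p - 1"] w0_pos[OF assms, of t] by simp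
  moreover have c: "(p + 1) / 2 = 1 + b" by (simp add: b_def field_simps)
  have "w0 p t powr (p - 1) = (1 + b) * (1 - T\<^sup>2)"
    using w0_powr_minus_1[OF assms, of t] unfolding c b_def[symmetric] C by simp
  ultimately have "w0 p t powr p = w0 p t * ((1 + b) * (1 - T\<^sup>2))" by simp
  moreover have "w0_slope p t = w0 p t * T" by (simp add: w0_slope_def T_def b_def)
  ultimately have "- w0_slope p t * T + w0 p t * ((1 - T\<^sup>2) * b) = w0 p t powr p - w0 p t"
    by (simp add: algebra_simps power2_eq_square)
  with d show ?thesis by (rule DERIV_cong)
qed

text \<open>
  With \<open>\<psi>' = w\<^sub>0\<^sup>p - w\<^sub>0\<close> from the previous lemma this is the linearised equation \<open>\<psi>'' = - q \<psi>\<close>.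
\<close>

lemma DERIV_w0_slope':
  assumes "p > 1"
  shows "((\<lambda>t. w0 p t powr p - w0 p t) has_real_derivative
    - (p * w0 p t powr (p - 1) - 1) * w0_slope p t) (at t)"
proof -
  have "((\<lambda>t. w0 p t powr p - w0 p t) has_real_derivative
      p * w0 p t powr (p - 1) * (- w0_slope p t) - (- w0_slope p t)) (at t)"
    using w0_pos[OF assms, of t]
    by (intro DERIV_diff DERIV_w0[OF assms] DERIV_chain2[where f = "\<lambda>y. y powr p"] has_real_derivative_powr)
  then show ?thesis by (simp add: algebra_simps)
qed

lemma w0_slope_bounds:
  assumes "p > 1" "t \<ge> 0"
  shows "w0_slope p t \<ge> 0" "w0_slope p t \<le> c_const p * ((p - 1) / 2) * t"
proof -
  have tanh_le: "tanh y \<le> y" if "y \<ge> 0" for y :: real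
  proof -
    have "(\<lambda>y. y - tanh y) 0 \<le> (\<lambda>y::real. y - tanh y) y"
    proof (rule DERIV_nonneg_imp_nondecreasing[OF that])
      fix x :: real
      show "\<exists>D. ((\<lambda>y. y - tanh y) has_real_derivative D) (at x) \<and> 0 \<le> D"
        by (intro exI[of _ "(tanh x)\<^sup>2"] conjI)
           (rule derivative_eq_intros refl | simp add: cosh_real_nonzero)+
    qed
    then show ?thesis by simp
  qed
  have T: "tanh ((p - 1) / 2 * t) \<le> (p - 1) / 2 * t" "0 \<le> tanh ((p - 1) / 2 * t)"
    using assms tanh_le[of "(p - 1) / 2 * t"] by auto
  then show "w0_slope p t \<ge> 0" using w0_pos[OF assms(1), of t] by (simp add: w0_slope_def)
  have "w0_slope p t \<le> c_const p * ((p - 1) / 2 * t)" unfolding w0_slope_def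
    using T w0_pos[OF assms(1), of t] w0_le[OF assms(1), of t] by (intro mult_mono) auto
  then show "w0_slope p t \<le> c_const p * ((p - 1) / 2) * t" by (simp add: mult.assoc)
qed

lemma w0_slope_pos: "p > 1 \<Longrightarrow> t > 0 \<Longrightarrow> w0_slope p t > 0"
  by (simp add: w0_slope_def w0_pos)

lemma w0_slope_deriv_bound:
  assumes "p > 1"
  shows "\<bar>w0 p t powr p - w0 p t\<bar> \<le> c_const p powr p + c_const p"
  using w0_le[OF assms, of t] w0_pos[OF assms, of t] powr_mono2[of p "w0 p t" "c_const p"] assms
    powr_ge_zero[of "w0 p t" p] by linarith

lemma w0_tendsto_0: assumes "p > 1" shows "(w0 p \<longlongrightarrow> 0) at_top"
proof -
  define b where "b = (p - 1) / 2"
  have b: "b > 0" "- 2 / (p - 1) = - 1 / b" using assms by (auto simp: b_def)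
  have "filterlim (\<lambda>t. b * t) at_top at_top"
    using b(1) by (simp add: filterlim_tendsto_pos_mult_at_top[OF tendsto_const _ filterlim_ident])
  then have "filterlim (\<lambda>t. cosh (b * t)) at_top at_top"
    by (rule filterlim_compose[OF cosh_real_at_top])
  then have "((\<lambda>t. cosh (b * t) powr (- 1 / b)) \<longlongrightarrow> 0) at_top"
    using b(1) by (intro tendsto_neg_powr) auto
  moreover have w: "w0 p = (\<lambda>t. c_const p * cosh (b * t) powr (- 1 / b))"
    by (intro ext) (simp only: w0_def b(2) b_def[symmetric])
  ultimately have "((\<lambda>t. c_const p * cosh (b * t) powr (- 1 / b)) \<longlongrightarrow> c_const p * 0) at_top"
    by (intro tendsto_mult tendsto_const) auto
  then show ?thesis by (simp add: w)
qed

lemma continuous_on_w0: "p > 1 \<Longrightarrow> continuous_on S (w0 p)"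
  and continuous_on_w0_slope: "p > 1 \<Longrightarrow> continuous_on S (w0_slope p)"
  by (auto intro!: DERIV_continuous_on[OF has_field_derivative_at_within] DERIV_w0 DERIV_w0_slope)

text \<open>
  Only the values of \<open>u\<close> on the half-space are prescribed, so the lemma can be applied to a partial
  derivative of \<open>u\<close> once more.
\<close>

lemma profile_C1:
  fixes u :: "(real ^ 'm) \<times> real \<Rightarrow> real"
  assumes u: "\<And>x. x \<in> half_space \<Longrightarrow> u x = f (snd x)"
    and f: "\<And>t. (f has_real_derivative f' t) (at t)" and f': "continuous_on UNIV f'"
  shows "C1_on u half_space"
    and "\<And>x. x \<in> half_space \<Longrightarrow> partial_deriv i u x = snd i * f' (snd x)"
proof -
  have diff: "u differentiable at x" if "x \<in> half_space" for x
  proof -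
    have "((\<lambda>x. f (snd x)) has_derivative (\<lambda>h. f' (snd x) * snd h)) (at x)"
      by (rule has_derivative_compose[OF _ f[THEN has_field_derivative_imp_has_derivative]])
         (auto intro!: derivative_intros)
    then have "(u has_derivative (\<lambda>h. f' (snd x) * snd h)) (at x)"
      by (rule has_derivative_transform_within_open[OF _ open_half_space that]) (simp add: u)
    then show ?thesis by (auto simp: differentiable_def)
  qed
  show pd: "partial_deriv i u x = snd i * f' (snd x)" if x: "x \<in> half_space" for x i
  proof -
    have "filterlim (\<lambda>s. x + s *\<^sub>R i) (nhds (x + 0 *\<^sub>R i)) (nhds (0::real))"
      by (intro tendsto_intros filterlim_ident)
    then have "\<forall>\<^sub>F s in nhds (0::real). x + s *\<^sub>R i \<in> half_space"
      using topological_tendstoD[OF _ open_half_space] x by simp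
    then have ev: "\<forall>\<^sub>F s in nhds 0. u (x + s *\<^sub>R i) = f (snd x + s * snd i)"
      by eventually_elim (simp add: u)
    have "((\<lambda>s. f (snd x + s * snd i)) has_real_derivative f' (snd x) * snd i) (at 0)"
      by (rule DERIV_chain2[where f = f]) (use f[of "snd x"] in \<open>auto intro!: derivative_eq_intros\<close>)
    with DERIV_cong_ev[OF refl ev refl] have "has_dir_deriv u i (f' (snd x) * snd i) x" by simp
    then show ?thesis unfolding partial_deriv_def by (simp add: DERIV_imp_deriv mult.commute)
  qed
  have "continuous_on half_space (partial_deriv i u)" for i
    by (subst continuous_on_cong[OF refl pd])
       (auto intro!: continuous_intros continuous_on_compose2[OF f'])
  then show "C1_on u half_space"
    by (auto simp: C1_on_def differentiable_on_def intro: diff differentiable_at_withinI)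
qed

lemma w0_profile_C2:
  fixes u :: "(real ^ 'm) \<times> real \<Rightarrow> real"
  assumes p: "p > 1" and u: "\<And>x. x \<in> half_space \<Longrightarrow> u x = w0 p (snd x)"
  shows "C2_on u half_space"
    and "\<And>x i. x \<in> half_space \<Longrightarrow>
      partial_deriv i (partial_deriv i u) x = (snd i)\<^sup>2 * (w0 p (snd x) - w0 p (snd x) powr p)"
proof -
  have c1: "continuous_on UNIV (\<lambda>t. - w0_slope p t)"
    using continuous_on_w0_slope[OF p] by (intro continuous_intros)
  have c2: "continuous_on UNIV (\<lambda>t. r * (w0 p t - w0 p t powr p))" for r
    using continuous_on_w0[OF p] w0_pos[OF p]
    by (intro continuous_intros) (auto simp: less_imp_neq[symmetric])
  have d2: "((\<lambda>t. snd i * - w0_slope p t) has_real_derivative snd i * (w0 p t - w0 p t powr p)) (at t)"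
    for t and i :: "(real ^ 'm) \<times> real"
    using DERIV_cmult[OF DERIV_minus[OF DERIV_w0_slope[OF p]], of "snd i" t] by simp
  show "C2_on u half_space" unfolding C2_on_def
    using profile_C1[OF u DERIV_w0[OF p] c1] profile_C1(1)[OF profile_C1(2)[OF u DERIV_w0[OF p] c1] d2 c2]
    by auto
  show "partial_deriv i (partial_deriv i u) x = (snd i)\<^sup>2 * (w0 p (snd x) - w0 p (snd x) powr p)"
    if "x \<in> half_space" for x i
    using profile_C1(2)[OF profile_C1(2)[OF u DERIV_w0[OF p] c1] d2 c2, of x i i] that
    by (simp add: power2_eq_square mult.assoc)
qed

lemma sum_Basis_prod_real:
  fixes f :: "('a::euclidean_space) \<times> real \<Rightarrow> real"
  shows "sum f Basis = (\<Sum>e\<in>Basis. f (e, 0)) + f (0, 1)"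
proof -
  have "inj_on (\<lambda>u. (u :: 'a, 0 :: real)) Basis" by (auto intro!: inj_onI)
  then show ?thesis
    unfolding Basis_prod_def by (subst sum.union_disjoint) (auto simp: sum.reindex)
qed

lemma w0_is_solution:
  fixes v :: "(real ^ 'm) \<times> real \<Rightarrow> real"
  assumes p: "p > 1" and v: "\<And>x. x \<in> closure half_space \<Longrightarrow> v x = w0 p (snd x)"
  shows "positive_bounded_solution p v"
proof -
  have vh: "v x = w0 p (snd x)" if "x \<in> half_space" for x
    using v that closure_subset by blast
  have lap: "laplacian v x = w0 p (snd x) - w0 p (snd x) powr p" if x: "x \<in> half_space" for x
    by (simp add: laplacian_def w0_profile_C2(2)[OF p vh x] sum_Basis_prod_real)
  have pw: "w0 p t powr p = w0 p t powr (p - 1) * w0 p t" for t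
    using powr_add[of "w0 p t" "p - 1" 1] w0_pos[OF p, of t] by simp
  have cont: "continuous_on (closure half_space) v"
    by (subst continuous_on_cong[OF refl v])
       (auto intro!: continuous_intros continuous_on_compose2[OF continuous_on_w0[OF p, of UNIV]])
  have fr: "v x = c_const p" if "x \<in> frontier half_space" for x
    using that v[of x] by (auto simp: frontier_half_space closure_half_space w0_0)
  have lim: "uniform_limit UNIV (\<lambda>t x'. v (x', t)) (\<lambda>x'. 0) at_top"
  proof (rule uniform_limitI)
    fix e :: real assume "e > 0"
    then have "\<forall>\<^sub>F t in at_top. dist (w0 p t) 0 < e"
      using w0_tendsto_0[OF p] by (rule tendstoD[rotated])
    with eventually_gt_at_top[of 0] show "\<forall>\<^sub>F t in at_top. \<forall>x'\<in>UNIV. dist (v (x', t)) 0 < e"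
      by eventually_elim (auto simp: vh half_space_def)
  qed
  have bd: "bounded (v ` half_space)"
    using w0_le[OF p] unfolding bounded_real
    by (intro exI[of _ "c_const p"]) (auto simp: vh abs_of_pos[OF w0_pos[OF p]])
  show ?thesis unfolding positive_bounded_solution_def dirichlet_solution_def
    using w0_profile_C2(1)[OF p vh] cont fr lim bd w0_pos[OF p]
    by (auto simp: vh lap pw abs_of_pos[OF w0_pos[OF p]])
qed

section \<open>Integrals over the tangential variables\<close>

lemma one_plus_inner_pos: "1 + x \<bullet> x > 0" for x :: "'a::real_inner"
  by (simp add: add_pos_nonneg)

text \<open>
  Dyadic comparison: on the shell of radius \<open>2\<^sup>k\<close> the function is at most \<open>16\<^sup>-\<^sup>k\<close>, while the ball of
  radius \<open>2\<^sup>k\<^sup>+\<^sup>1\<close> has volume at most a multiple of \<open>4\<^sup>k\<close> in dimension one or two.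
\<close>

lemma integrable_inverse_square:
  assumes "DIM('a::euclidean_space) \<le> 2"
  shows "integrable lborel (\<lambda>x::'a. 1 / (1 + x \<bullet> x)\<^sup>2)"
proof (rule integrableI_bounded)
  show "(\<lambda>x::'a. 1 / (1 + x \<bullet> x)\<^sup>2) \<in> borel_measurable lborel" by measurable
  define V where "V = unit_ball_vol (real DIM('a))"
  define F where "F = (\<lambda>k (x::'a). ennreal (1 / 16 ^ k) * indicator (cball 0 (2 ^ Suc k)) x)"
  have le: "ennreal (norm (1 / (1 + x \<bullet> x)\<^sup>2)) \<le> (\<Sum>k. F k x)" for x :: 'a
  proof -
    \<comment> \<open>The index of the dyadic shell of \<open>x\<close>; the ball of radius two is the case \<open>k = 0\<close>.\<close>
    define k where "k = (LEAST k. norm x \<le> 2 ^ Suc k)"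
    obtain m where "norm x < 2 ^ m" using real_arch_pow[of 2 "norm x"] by auto
    then have "norm x \<le> 2 ^ Suc m" using norm_ge_zero[of x] unfolding power_Suc by linarith
    then have k: "norm x \<le> 2 ^ Suc k" unfolding k_def by (rule LeastI)
    have "16 ^ k \<le> (1 + x \<bullet> x)\<^sup>2"
    proof (cases k)
      case (Suc j)
      then have "j < k" by simp
      then have "\<not> norm x \<le> 2 ^ Suc j" unfolding k_def by (rule not_less_Least)
      then have "(2 ^ k)\<^sup>2 \<le> (norm x)\<^sup>2" unfolding Suc by (intro power_mono) auto
      also have "\<dots> \<le> 1 + x \<bullet> x" by (simp add: power2_norm_eq_inner)
      finally have "((2 ^ k)\<^sup>2)\<^sup>2 \<le> (1 + x \<bullet> x)\<^sup>2" by (intro power_mono) auto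
      moreover have "((2 ^ k)\<^sup>2)\<^sup>2 = (16::real) ^ k"
        by (simp add: power_mult[symmetric] mult.commute[of k]) (simp add: power_mult)
      ultimately show ?thesis by simp
    qed (simp add: one_le_power)
    then have "1 / (1 + x \<bullet> x)\<^sup>2 \<le> 1 / 16 ^ k"
      using one_plus_inner_pos[of x] by (intro divide_left_mono) auto
    then have "ennreal (norm (1 / (1 + x \<bullet> x)\<^sup>2)) \<le> F k x"
      using k by (simp add: F_def ennreal_leI)
    also have "\<dots> \<le> (\<Sum>k. F k x)"
      using sum_le_suminf[of "\<lambda>k. F k x" "{k}"] by simp
    finally show ?thesis .
  qed
  have int_F: "(\<integral>\<^sup>+x. F k x \<partial>lborel) \<le> ennreal (4 * V * (1 / 4) ^ k)" for k
  proof -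
    have "((2::real) ^ Suc k) ^ DIM('a) \<le> (2 ^ Suc k)\<^sup>2"
      using assms by (intro power_increasing one_le_power) simp_all
    also have "(2 ^ Suc k)\<^sup>2 = 4 * (4::real) ^ k"
      by (simp add: power_mult_distrib power_mult[symmetric] mult.commute[of k]) (simp add: power_mult)
    finally have "V * (2 ^ Suc k) ^ DIM('a) \<le> V * (4 * 4 ^ k)"
      unfolding V_def by (intro mult_left_mono) auto
    then have "1 / 16 ^ k * (V * (2 ^ Suc k) ^ DIM('a)) \<le> 1 / 16 ^ k * (V * (4 * 4 ^ k))"
      by (rule mult_left_mono) simp
    also have "\<dots> = 4 * V * (1 / 4) ^ k"
      using power_mult_distrib[of 4 "4::real" k] by (simp add: power_one_over field_simps)
    finally have "1 / 16 ^ k * (V * (2 ^ Suc k) ^ DIM('a)) \<le> 4 * V * (1 / 4) ^ k" .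
    moreover have eq: "(\<integral>\<^sup>+x. F k x \<partial>lborel) =
          ennreal (1 / 16 ^ k) * emeasure lborel (cball (0::'a) (2 ^ Suc k))"
      unfolding F_def by (rule nn_integral_cmult_indicator) simp
    have vol: "emeasure lborel (cball (0::'a) (2 ^ Suc k)) = ennreal (V * (2 ^ Suc k) ^ DIM('a))"
      unfolding V_def by (rule emeasure_cball) simp
    have "(\<integral>\<^sup>+x. F k x \<partial>lborel) = ennreal (1 / 16 ^ k * (V * (2 ^ Suc k) ^ DIM('a)))"
      unfolding eq vol by (rule ennreal_mult'[symmetric]) simp
    ultimately show ?thesis by (simp add: ennreal_leI)
  qed
  have "(\<integral>\<^sup>+x. ennreal (norm (1 / (1 + x \<bullet> (x::'a))\<^sup>2)) \<partial>lborel) \<le> (\<integral>\<^sup>+x. (\<Sum>k. F k (x::'a)) \<partial>lborel)"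
    by (intro nn_integral_mono le)
  also have "\<dots> = (\<Sum>k. \<integral>\<^sup>+x. F k x \<partial>lborel)"
    unfolding F_def
      by (intro nn_integral_suminf borel_measurable_times_ennreal borel_measurable_indicator) auto
  also have "\<dots> \<le> (\<Sum>k. ennreal (4 * V * (1 / 4) ^ k))"
    by (intro suminf_le int_F) auto
  also have "\<dots> < \<infinity>"
  proof -
    have "summable (\<lambda>k. 4 * V * (1 / 4) ^ k)" by (intro summable_mult summable_geometric) auto
    then have "(\<Sum>k. ennreal (4 * V * (1 / 4) ^ k)) \<noteq> top"
      by (intro ennreal_suminf_neq_top) (auto simp: V_def)
    then show ?thesis by (simp add: less_top)
  qed
  finally show "(\<integral>\<^sup>+x. ennreal (norm (1 / (1 + x \<bullet> (x::'a))\<^sup>2)) \<partial>lborel) < \<infinity>" .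
qed

lemma has_bochner_integral_product:
  fixes f :: "'a::euclidean_space \<Rightarrow> real" and g :: "'b::euclidean_space \<Rightarrow> real"
  assumes fI: "has_bochner_integral lborel f I" and gJ: "has_bochner_integral lborel g J"
  shows "has_bochner_integral lborel (\<lambda>x. f (fst x) * g (snd x)) (I * J)"
proof -
  have f: "integrable lborel f" and g: "integrable lborel g"
    using fI gJ by (simp_all add: has_bochner_integral_iff)
  have m: "f \<in> borel_measurable borel" "g \<in> borel_measurable borel"
    using f g borel_measurable_integrable by force+
  have i: "integrable (lborel \<Otimes>\<^sub>M lborel) (\<lambda>x. f (fst x) * g (snd x))"
  proof (rule lborel_pair.Fubini_integrable)
    show "(\<lambda>x. f (fst x) * g (snd x)) \<in> borel_measurable (lborel \<Otimes>\<^sub>M lborel)"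
      using m by measurable
    show "integrable lborel (\<lambda>x. LINT y|lborel. norm (f (fst (x, y)) * g (snd (x, y))))"
      using f by (simp add: abs_mult integrable_abs)
    show "AE x in lborel. integrable lborel (\<lambda>y. f (fst (x, y)) * g (snd (x, y)))"
      using g by simp
  qed
  then have "(LINT x|(lborel \<Otimes>\<^sub>M lborel). f (fst x) * g (snd x)) =
        (LINT x|lborel. f x) * (LINT y|lborel. g y)"
    by (subst lborel_pair.integral_fst'[symmetric]) auto
  then show ?thesis using i fI gJ by (simp add: has_bochner_integral_iff lborel_prod)
qed

section \<open>The logarithmic cutoff in the tangential variables\<close>

definition tangential_base :: "real \<Rightarrow> 'a::euclidean_space \<Rightarrow> real" where
  "tangential_base n x = max 0 (1 - ln (1 + x \<bullet> x) / n)"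

definition tangential_cutoff :: "real \<Rightarrow> 'a::euclidean_space \<Rightarrow> real" where
  "tangential_cutoff n x = tangential_base n x ^ 3"

text \<open>
  The first and second derivatives of the cutoff in the direction of a basis vector \<open>e\<close>.
\<close>

definition tangential_cutoff' :: "real \<Rightarrow> 'a \<Rightarrow> 'a::euclidean_space \<Rightarrow> real" where
  "tangential_cutoff' n e x = 3 * (tangential_base n x)\<^sup>2 * (- (2 * (x \<bullet> e) / (1 + x \<bullet> x)) / n)"

definition tangential_cutoff'' :: "real \<Rightarrow> 'a \<Rightarrow> 'a::euclidean_space \<Rightarrow> real" where
  "tangential_cutoff'' n e x = 6 * tangential_base n x * (2 * (x \<bullet> e) / (1 + x \<bullet> x) / n)\<^sup>2
    - 6 / n * (tangential_base n x)\<^sup>2 * (1 / (1 + x \<bullet> x) - 2 * (x \<bullet> e)\<^sup>2 / (1 + x \<bullet> x)\<^sup>2)"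

lemma DERIV_pos_part:
  shows "((\<lambda>s. max 0 s ^ 3) has_real_derivative 3 * (max 0 s)\<^sup>2) (at (s::real))"
    and "((\<lambda>s. (max 0 s)\<^sup>2) has_real_derivative 2 * max 0 s) (at (s::real))"
  using DERIV_pos_part_power[of 2 s] DERIV_pos_part_power[of 1 s]
  by (simp_all add: eval_nat_numeral)

lemma tangential_base_line:
  fixes x e :: "'a::euclidean_space"
  shows "((\<lambda>s. 1 - ln (1 + (x + s *\<^sub>R e) \<bullet> (x + s *\<^sub>R e)) / n) has_real_derivative
      - (2 * (x \<bullet> e) / (1 + x \<bullet> x)) / n) (at 0)"
proof -
  have "((\<lambda>s. (x + s *\<^sub>R e) \<bullet> (x + s *\<^sub>R e)) has_real_derivative 2 * (x \<bullet> e)) (at 0)"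
    by (simp add: inner_add inner_commute[of e x]) (rule derivative_eq_intros refl | simp)+
  then have "((\<lambda>s. ln (1 + (x + s *\<^sub>R e) \<bullet> (x + s *\<^sub>R e))) has_real_derivative
      2 * (x \<bullet> e) / (1 + x \<bullet> x)) (at 0)"
    using one_plus_inner_pos[of x] by - (rule derivative_eq_intros refl | simp)+
  from DERIV_diff[OF DERIV_const DERIV_cdivide[OF this]] show ?thesis by simp
qed

lemma tangential_cutoff_derivs:
  assumes e: "e \<in> Basis"
  shows "has_dir_deriv (tangential_cutoff n) e (tangential_cutoff' n e x) x"
    "has_dir_deriv (tangential_cutoff' n e) e (tangential_cutoff'' n e x) x"
proof -
  note line = tangential_base_line[of x e n]
  show "has_dir_deriv (tangential_cutoff n) e (tangential_cutoff' n e x) x"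
    unfolding tangential_cutoff_def tangential_cutoff'_def tangential_base_def
    by (rule DERIV_chain2[OF _ line]) (simp add: DERIV_pos_part)
  have sq: "((\<lambda>s. (tangential_base n (x + s *\<^sub>R e))\<^sup>2) has_real_derivative
      2 * tangential_base n x * (- (2 * (x \<bullet> e) / (1 + x \<bullet> x)) / n)) (at 0)"
    unfolding tangential_base_def by (rule DERIV_chain2[OF _ line]) (simp add: DERIV_pos_part)
  have in1: "((\<lambda>s. (x + s *\<^sub>R e) \<bullet> e) has_real_derivative 1) (at 0)"
    using e by (simp add: inner_add) (rule derivative_eq_intros refl | simp)+
  have in2: "((\<lambda>s. (x + s *\<^sub>R e) \<bullet> (x + s *\<^sub>R e)) has_real_derivative 2 * (x \<bullet> e)) (at 0)"
    by (simp add: inner_add inner_commute[of e x]) (rule derivative_eq_intros refl | simp)+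
  have nz: "1 + x \<bullet> x \<noteq> 0" using one_plus_inner_pos[of x] by simp
  have "((\<lambda>s. ((x + s *\<^sub>R e) \<bullet> e) / (1 + (x + s *\<^sub>R e) \<bullet> (x + s *\<^sub>R e)))
      has_real_derivative 1 / (1 + x \<bullet> x) - 2 * (x \<bullet> e)\<^sup>2 / (1 + x \<bullet> x)\<^sup>2) (at 0)"
    by (rule DERIV_cong[OF DERIV_divide[OF in1 DERIV_add[OF DERIV_const in2]]])
       (use nz in \<open>auto simp: diff_divide_distrib power2_eq_square\<close>)
  from DERIV_cmult[OF this, of "- (2 / n)"]
  have quot: "((\<lambda>s. - (2 * ((x + s *\<^sub>R e) \<bullet> e) / (1 + (x + s *\<^sub>R e) \<bullet> (x + s *\<^sub>R e))) / n)
      has_real_derivative - (2 / n) * (1 / (1 + x \<bullet> x) - 2 * (x \<bullet> e)\<^sup>2 / (1 + x \<bullet> x)\<^sup>2)) (at 0)"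
    by (simp add: mult.commute)
  show "has_dir_deriv (tangential_cutoff' n e) e (tangential_cutoff'' n e x) x"
    unfolding tangential_cutoff'_def
    by (rule DERIV_cong[OF DERIV_mult[OF DERIV_cmult[OF sq] quot]])
       (simp add: tangential_cutoff''_def power2_eq_square algebra_simps)
qed

lemma continuous_on_tangential_base: "continuous_on S (tangential_base n)"
  unfolding tangential_base_def divide_inverse
  by (intro continuous_intros) (simp_all add: one_plus_inner_pos less_imp_neq[OF one_plus_inner_pos, symmetric])

lemma continuous_on_tangential_cutoff:
  "continuous_on S (tangential_cutoff n)"
    "continuous_on S (tangential_cutoff' n e)"
    "continuous_on S (tangential_cutoff'' n e)"
  unfolding tangential_cutoff_def tangential_cutoff'_def tangential_cutoff''_def divide_inverse
  by (intro continuous_intros continuous_on_tangential_base;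
      simp add: less_imp_neq[OF one_plus_inner_pos, symmetric])+

lemma tangential_base_le_1: "n > 0 \<Longrightarrow> tangential_base n x \<le> 1"
  by (simp add: tangential_base_def)

lemma tangential_cutoff_bounds: "0 \<le> tangential_cutoff n x" "n > 0 \<Longrightarrow> tangential_cutoff n x \<le> 1"
  using tangential_base_le_1[of n x]
    by (auto simp: tangential_cutoff_def tangential_base_def intro!: power_le_one)

lemma tangential_base_eq_0:
  assumes "n > 0" "x \<notin> cball 0 (exp n)"
  shows "tangential_base n x = 0"
proof -
  have x: "exp n < norm x" using assms by simp
  then have "exp n * 1 \<le> norm x * norm x" using assms
    by (intro mult_mono) (auto intro: order.trans[of _ "exp n"])
  then have "exp n \<le> 1 + x \<bullet> x" by (simp add: power2_norm_eq_inner[symmetric] power2_eq_square)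
  then have "n \<le> ln (1 + x \<bullet> x)" using one_plus_inner_pos[of x] by (simp add: ln_ge_iff)
  then show ?thesis using assms by (simp add: tangential_base_def)
qed

text \<open>
  For \<open>\<eta> = k(u)\<close> with \<open>u = ln (1 + |x|\<^sup>2) / n\<close> and \<open>k(u) = (1 - u)\<^sub>+\<^sup>3\<close>, one has
  \<open>\<Delta>\<eta> = k''(u) |\<nabla>u|\<^sup>2 + k'(u) \<Delta>u\<close>. The first term is nonnegative since \<open>k\<close> is convex. In the second,
  \<open>- 3 \<le> k' \<le> 0\<close>, and \<open>\<Delta>u \<le> (4 / n) (1 + |x|\<^sup>2)\<^sup>-\<^sup>2\<close> because the fundamental solution is logarithmic in
  dimension two. This is where the restriction on the dimension enters.
\<close>

lemma tangential_cutoff_laplacian_ge: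
  fixes x :: "'a::euclidean_space"
  assumes "DIM('a) \<le> 2" "n > 0"
  shows "(\<Sum>e\<in>Basis. tangential_cutoff'' n e x) \<ge> - (12 / n * (1 / (1 + x \<bullet> x)\<^sup>2))"
proof -
  define s where "s = x \<bullet> x"
  define X where "X = (\<lambda>e. 1 / (1 + s) - 2 * (x \<bullet> e)\<^sup>2 / (1 + s)\<^sup>2)"
  define m where "m = tangential_base n x"
  have s: "s \<ge> 0" "(\<Sum>e\<in>Basis. (x \<bullet> e)\<^sup>2) = s"
    by (simp add: s_def) (simp add: s_def euclidean_inner[of x x] power2_eq_square)
  have m: "0 \<le> m" "m\<^sup>2 \<le> 1"
    using assms tangential_base_le_1[of n x] by (auto simp: m_def tangential_base_def power_le_one)
  have "(\<Sum>e\<in>Basis. X e) = DIM('a) / (1 + s) - 2 * s / (1 + s)\<^sup>2"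
    by (simp add: X_def sum_subtractf s(2) sum_distrib_left[symmetric] sum_divide_distrib[symmetric])
  also have "\<dots> \<le> 2 / (1 + s) - 2 * s / (1 + s)\<^sup>2"
    using assms s by (intro diff_right_mono divide_right_mono) auto
  also have "\<dots> = 2 / (1 + s)\<^sup>2"
    using s(1) by (simp add: divide_simps) (simp add: power2_eq_square algebra_simps)
  finally have "m\<^sup>2 * (\<Sum>e\<in>Basis. X e) \<le> m\<^sup>2 * (2 / (1 + s)\<^sup>2)"
    using m by (intro mult_left_mono) auto
  also have "\<dots> \<le> 2 / (1 + s)\<^sup>2" using m(2) s by (intro mult_left_le_one_le) auto
  finally have "6 / n * (m\<^sup>2 * (\<Sum>e\<in>Basis. X e)) \<le> 6 / n * (2 / (1 + s)\<^sup>2)"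
    using assms by (intro mult_left_mono) auto
  moreover have second_deriv_eq: "tangential_cutoff'' n e x = 6 * m * (2 * (x \<bullet> e) / (1 + s) / n)\<^sup>2 - 6 / n * (m\<^sup>2 * X e)"
    for e
    by (simp add: tangential_cutoff''_def m_def s_def X_def)
  have "(\<Sum>e\<in>Basis. tangential_cutoff'' n e x) =
      (\<Sum>e\<in>Basis. 6 * m * (2 * (x \<bullet> e) / (1 + s) / n)\<^sup>2)
      - 6 / n * (m\<^sup>2 * (\<Sum>e\<in>Basis. X e))"
    by (simp only: second_deriv_eq sum_subtractf sum_distrib_left)
  moreover have "(\<Sum>e\<in>Basis. 6 * m * (2 * (x \<bullet> e) / (1 + s) / n)\<^sup>2) \<ge> 0"
    using m by (intro sum_nonneg) auto
  ultimately show ?thesis by (simp add: s_def[symmetric])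
qed

section \<open>The cutoff in the normal variable\<close>

text \<open>
  The weight \<open>t + 1/t\<close> is proper on \<open>t > 0\<close>, so that one expression cuts off both near the boundary
  and near infinity.
\<close>

definition normal_base :: "real \<Rightarrow> real \<Rightarrow> real" where
  "normal_base d t = max 0 (1 - d * (t + 1 / t))"

definition normal_cutoff :: "real \<Rightarrow> real \<Rightarrow> real" where
  "normal_cutoff d t = normal_base d t ^ 3"

definition normal_cutoff' :: "real \<Rightarrow> real \<Rightarrow> real" where
  "normal_cutoff' d t = 3 * (normal_base d t)\<^sup>2 * (- (d * (1 - 1 / t\<^sup>2)))"

definition normal_cutoff'' :: "real \<Rightarrow> real \<Rightarrow> real" where
  "normal_cutoff'' d t = 6 * normal_base d t * (d * (1 - 1 / t\<^sup>2))\<^sup>2 - 6 * (normal_base d t)\<^sup>2 * (d / t ^ 3)"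

lemma normal_cutoff_derivs:
  assumes t: "t > 0"
  shows "(normal_cutoff d has_real_derivative normal_cutoff' d t) (at t)"
    "(normal_cutoff' d has_real_derivative normal_cutoff'' d t) (at t)"
proof -
  have line: "((\<lambda>t. 1 - d * (t + 1 / t)) has_real_derivative - (d * (1 - 1 / t\<^sup>2))) (at t)"
    using t by - (rule derivative_eq_intros refl | simp add: power2_eq_square)+
  show "(normal_cutoff d has_real_derivative normal_cutoff' d t) (at t)"
    unfolding normal_cutoff_def normal_cutoff'_def normal_base_def
    by (rule DERIV_chain2[OF _ line]) (simp add: DERIV_pos_part)
  have sq: "((\<lambda>t. (normal_base d t)\<^sup>2) has_real_derivative 2 * normal_base d t * - (d * (1 - 1 / t\<^sup>2))) (at t)"
    unfolding normal_base_def by (rule DERIV_chain2[OF _ line]) (simp add: DERIV_pos_part)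
  have lin: "((\<lambda>t. - (d * (1 - 1 / t\<^sup>2))) has_real_derivative - (2 * d / t ^ 3)) (at t)"
    using t by - (rule derivative_eq_intros refl | simp add: field_simps eval_nat_numeral)+
  show "(normal_cutoff' d has_real_derivative normal_cutoff'' d t) (at t)"
    unfolding normal_cutoff'_def
    by (rule DERIV_cong[OF DERIV_mult[OF DERIV_cmult[OF sq] lin]])
       (simp add: normal_cutoff''_def power2_eq_square)
qed

lemma normal_base_bounds: "0 \<le> normal_base d t" "d > 0 \<Longrightarrow> t > 0 \<Longrightarrow> normal_base d t \<le> 1"
  by (auto simp: normal_base_def)

lemma normal_cutoff_bounds: "0 \<le> normal_cutoff d t" "d > 0 \<Longrightarrow> t > 0 \<Longrightarrow> normal_cutoff d t \<le> 1"
  using normal_base_bounds[of d t] by (auto simp: normal_cutoff_def intro!: power_le_one)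

lemma normal_base_eq_0:
  assumes "d > 0" "t > 0" "t \<notin> {d..1 / d}"
  shows "normal_base d t = 0"
proof -
  have "1 \<le> d * (t + 1 / t)"
  proof (cases "t < d")
    case True
    then have "1 \<le> d * (1 / t)" using assms by (simp add: field_simps)
    also have "\<dots> \<le> d * (t + 1 / t)" using assms by (intro mult_left_mono) auto
    finally show ?thesis .
  next
    case False
    then have "1 \<le> d * t" using assms by (auto simp: field_simps)
    also have "\<dots> \<le> d * (t + 1 / t)" using assms by (intro mult_left_mono) auto
    finally show ?thesis .
  qed
  then show ?thesis by (simp add: normal_base_def)
qed

text \<open>
  The second bound gains a factor \<open>t\<close>, which the linear vanishing of \<open>\<psi>\<close> at \<open>0\<close> pays for later. It
  rests on \<open>1 + 1/t\<^sup>2 = (t + 1/t) / t\<close>: on the support of the cutoff \<open>d (t + 1/t) \<le> 1\<close>, so one of the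
  two factors \<open>d\<close> in the square of the first derivative is absorbed.
\<close>

lemma normal_cutoff_deriv_bounds:
  assumes "d > 0" "t > 0"
  shows "\<bar>normal_cutoff' d t\<bar> \<le> 3 * (d * (1 + 1 / t\<^sup>2))"
    "t * \<bar>normal_cutoff'' d t\<bar> \<le> 12 * (d * (1 + 1 / t\<^sup>2))"
proof -
  define m where "m = normal_base d t"
  define r where "r = 1 + 1 / t\<^sup>2"
  have m: "0 \<le> m" "m \<le> 1" "m\<^sup>2 \<le> 1"
    using normal_base_bounds[of d t] assms by (auto simp: m_def power_le_one)
  have r: "\<bar>1 - 1 / t\<^sup>2\<bar> \<le> r" "0 \<le> r" by (auto simp: r_def abs_le_iff)
  have "\<bar>normal_cutoff' d t\<bar> = m\<^sup>2 * (3 * (d * \<bar>1 - 1 / t\<^sup>2\<bar>))"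
    using assms by (simp add: normal_cutoff'_def m_def[symmetric] abs_mult)
  also have "\<dots> \<le> 1 * (3 * (d * r))" using m r assms by (intro mult_mono) auto
  finally show "\<bar>normal_cutoff' d t\<bar> \<le> 3 * (d * (1 + 1 / t\<^sup>2))" by (simp add: r_def)
  have 1: "t * (m * (d * (1 - 1 / t\<^sup>2))\<^sup>2) \<le> d * r"
  proof (cases "m = 0")
    case False
    then have "d * (t + 1 / t) \<le> 1" by (auto simp: m_def normal_base_def max_def split: if_splits)
    moreover have tr: "t + 1 / t = t * r" using assms by (simp add: r_def field_simps power2_eq_square)
    ultimately have dt: "d * (t * r) \<le> 1" by simp
    have "(d * (1 - 1 / t\<^sup>2))\<^sup>2 \<le> (d * r)\<^sup>2"
      unfolding abs_le_square_iff[symmetric] using r assms by (simp add: abs_mult)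
    then have "t * (m * (d * (1 - 1 / t\<^sup>2))\<^sup>2) \<le> t * (1 * (d * r)\<^sup>2)"
      using assms m by (intro mult_mono mult_left_mono) auto
    also have "\<dots> = d * (t * r) * (d * r)" by (simp add: power2_eq_square)
    also have "\<dots> \<le> 1 * (d * r)" using dt r assms by (intro mult_right_mono) auto
    finally show ?thesis by simp
  qed (use assms r in simp)
  have "t * (m\<^sup>2 * (d / t ^ 3)) \<le> t * (1 * (d / t ^ 3))"
    using assms m by (intro mult_left_mono mult_right_mono) auto
  also have "\<dots> = d * (1 / t\<^sup>2)" using assms by (simp add: field_simps eval_nat_numeral)
  also have "\<dots> \<le> d * r" using assms by (intro mult_left_mono) (auto simp: r_def)
  finally have 2: "t * (m\<^sup>2 * (d / t ^ 3)) \<le> d * r" .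
  have "t * \<bar>normal_cutoff'' d t\<bar> = \<bar>6 * (t * (m * (d * (1 - 1 / t\<^sup>2))\<^sup>2)) - 6 * (t * (m\<^sup>2 * (d / t ^ 3)))\<bar>"
    using assms unfolding normal_cutoff''_def m_def[symmetric]
    by (subst abs_of_pos[OF assms(2), symmetric], subst abs_mult[symmetric]) (simp add: algebra_simps)
  also have "\<dots> \<le> 12 * (d * r)"
    using 1 2 assms m by (intro order.trans[OF abs_triangle_ineq4]) auto
  finally show "t * \<bar>normal_cutoff'' d t\<bar> \<le> 12 * (d * (1 + 1 / t\<^sup>2))" by (simp add: r_def)
qed

section \<open>The equation tested with cutoffs of the kernel element\<close>

lemma tangent_above_powr:
  fixes u w :: real
  assumes "p > 1" "u > 0" "w > 0" "u \<noteq> w"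
  shows "u powr p - w powr p - p * w powr (p - 1) * (u - w) > 0"
proof (cases "u > w")
  case True
  have "\<exists>z>w. z < u \<and> u powr p - w powr p = (u - w) * (p * z powr (p - 1))"
    by (rule MVT2[OF True]) (use assms in \<open>auto intro!: has_real_derivative_powr\<close>)
  then obtain z where z: "w < z" "u powr p - w powr p = (u - w) * (p * z powr (p - 1))" by blast
  have "(u - w) * (p * w powr (p - 1)) < (u - w) * (p * z powr (p - 1))"
    using assms True z(1) by (intro mult_strict_left_mono powr_less_mono2) auto
  then show ?thesis using z(2) by (simp add: algebra_simps)
next
  case False
  then have "u < w" using assms by simp
  then have "\<exists>z>u. z < w \<and> w powr p - u powr p = (w - u) * (p * z powr (p - 1))"
    by (rule MVT2) (use assms in \<open>auto intro!: has_real_derivative_powr\<close>)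
  then obtain z where z: "u < z" "z < w" "w powr p - u powr p = (w - u) * (p * z powr (p - 1))" by blast
  have "(w - u) * (p * z powr (p - 1)) < (w - u) * (p * w powr (p - 1))"
    using assms \<open>u < w\<close> z by (intro mult_strict_left_mono powr_less_mono2) auto
  then show ?thesis using z(3) by (simp add: algebra_simps)
qed

text \<open>
  The function \<open>\<theta> = \<psi> \<chi>\<close> and its first two derivatives. By \<open>\<psi>'' = - q \<psi>\<close> the second one is
  \<open>- q \<theta>\<close> plus terms with derivatives of the cutoff, collected in \<open>cutoff_error\<close>.
\<close>

definition test_profile :: "real \<Rightarrow> real \<Rightarrow> real \<Rightarrow> real" where
  "test_profile p d t = w0_slope p t * normal_cutoff d t"

definition test_profile' :: "real \<Rightarrow> real \<Rightarrow> real \<Rightarrow> real" where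
  "test_profile' p d t = (w0 p t powr p - w0 p t) * normal_cutoff d t + w0_slope p t * normal_cutoff' d t"

definition cutoff_error :: "real \<Rightarrow> real \<Rightarrow> real \<Rightarrow> real" where
  "cutoff_error p d t =
        2 * (w0 p t powr p - w0 p t) * normal_cutoff' d t + w0_slope p t * normal_cutoff'' d t"

definition test_profile'' :: "real \<Rightarrow> real \<Rightarrow> real \<Rightarrow> real" where
  "test_profile'' p d t = - (p * w0 p t powr (p - 1) - 1) * test_profile p d t + cutoff_error p d t"

lemma test_profile_derivs:
  assumes "p > 1" "t > 0"
  shows "(test_profile p d has_real_derivative test_profile' p d t) (at t)"
    "(test_profile' p d has_real_derivative test_profile'' p d t) (at t)"
proof -
  note s = DERIV_w0_slope[OF assms(1), of t] and s' = DERIV_w0_slope'[OF assms(1), of t]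
    and n = normal_cutoff_derivs[OF assms(2), of d]
  show "(test_profile p d has_real_derivative test_profile' p d t) (at t)"
    unfolding test_profile_def
      by (rule DERIV_cong[OF DERIV_mult[OF s n(1)]]) (simp add: test_profile'_def)
  show "(test_profile' p d has_real_derivative test_profile'' p d t) (at t)"
    unfolding test_profile'_def
    by (rule DERIV_cong[OF DERIV_add[OF DERIV_mult[OF s' n(1)] DERIV_mult[OF s n(2)]]])
       (simp add: test_profile''_def test_profile_def cutoff_error_def algebra_simps)
qed

lemma test_profile_bounds:
  assumes "p > 1" "d > 0" "t > 0"
  shows "0 \<le> test_profile p d t" "test_profile p d t \<le> w0_slope p t"
  using w0_slope_bounds[of p t] normal_cutoff_bounds[of d t] assms
  by (auto simp: test_profile_def intro: mult_left_le)

lemma test_profile_eq_0: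
  assumes "d > 0" "t > 0" "t \<notin> {d..1 / d}"
  shows "test_profile p d t = 0" "test_profile' p d t = 0" "cutoff_error p d t = 0"
  using normal_base_eq_0[OF assms]
    by (simp_all add: test_profile_def test_profile'_def cutoff_error_def normal_cutoff_def normal_cutoff'_def normal_cutoff''_def)

definition error_const :: "real \<Rightarrow> real" where
  "error_const p = 6 * (c_const p powr p + c_const p) + 6 * (c_const p * (p - 1))"

lemma error_const_pos: "p > 1 \<Longrightarrow> error_const p > 0"
  using c_const_pos[of p] unfolding error_const_def by (intro add_pos_pos mult_pos_pos) auto

lemma cutoff_error_bound:
  assumes "p > 1" "d > 0" "t > 0"
  shows "\<bar>cutoff_error p d t\<bar> \<le> error_const p * (d * (1 + 1 / t\<^sup>2))"
proof -
  define r where "r = d * (1 + 1 / t\<^sup>2)"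
  define k where "k = c_const p * ((p - 1) / 2)"
  have k: "k \<ge> 0" using c_const_pos assms by (simp add: k_def less_imp_le)
  have n: "\<bar>normal_cutoff' d t\<bar> \<le> 3 * r" "t * \<bar>normal_cutoff'' d t\<bar> \<le> 12 * r"
    unfolding r_def by (rule normal_cutoff_deriv_bounds[OF assms(2,3)])+
  have "\<bar>w0 p t powr p - w0 p t\<bar> * \<bar>normal_cutoff' d t\<bar> \<le> (c_const p powr p + c_const p) * (3 * r)"
    using w0_slope_deriv_bound[OF assms(1), of t] n(1) by (intro mult_mono) auto
  moreover have "w0_slope p t * \<bar>normal_cutoff'' d t\<bar> \<le> k * t * \<bar>normal_cutoff'' d t\<bar>"
    using w0_slope_bounds[of p t] assms by (intro mult_right_mono) (auto simp: k_def)
  moreover have "k * (t * \<bar>normal_cutoff'' d t\<bar>) \<le> k * (12 * r)" using n(2) k by (rule mult_left_mono)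
  moreover have "cutoff_error p d t =
        2 * ((w0 p t powr p - w0 p t) * normal_cutoff' d t) + w0_slope p t * normal_cutoff'' d t"
    by (simp add: cutoff_error_def mult.assoc)
  then have "\<bar>cutoff_error p d t\<bar> \<le>
        \<bar>2 * ((w0 p t powr p - w0 p t) * normal_cutoff' d t)\<bar> + \<bar>w0_slope p t * normal_cutoff'' d t\<bar>"
    by (simp only: abs_triangle_ineq)
  then have "\<bar>cutoff_error p d t\<bar> \<le>
        2 * (\<bar>w0 p t powr p - w0 p t\<bar> * \<bar>normal_cutoff' d t\<bar>) + w0_slope p t * \<bar>normal_cutoff'' d t\<bar>"
    using w0_slope_bounds(1)[of p t] assms by (simp only: abs_mult) simp
  ultimately have "\<bar>cutoff_error p d t\<bar> \<le> 2 * ((c_const p powr p + c_const p) * (3 * r)) + k * (12 * r)"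
    by (simp add: mult.assoc)
  also have "\<dots> = (6 * (c_const p powr p + c_const p) + 6 * (c_const p * (p - 1))) * r"
    by (simp add: k_def field_simps)
  finally show ?thesis by (simp only: r_def error_const_def)
qed

lemma continuous_on_test_profile:
  assumes "p > 1" "S \<subseteq> {0<..}"
  shows "continuous_on S (test_profile p d)"
    "continuous_on S (test_profile' p d)"
    "continuous_on S (test_profile'' p d)"
proof -
  have n: "continuous_on S (normal_base d)" "continuous_on S (normal_cutoff'' d)"
    using assms(2) unfolding normal_cutoff''_def normal_base_def by (auto intro!: continuous_intros)
  show 1: "continuous_on S (test_profile p d)" "continuous_on S (test_profile' p d)"
    by (rule DERIV_continuous_on[OF has_field_derivative_at_within[OF test_profile_derivs(1)[OF assms(1)]]]
             DERIV_continuous_on[OF has_field_derivative_at_within[OF test_profile_derivs(2)[OF assms(1)]]];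
        use assms(2) in auto)+
  have "continuous_on S (normal_cutoff' d)"
    by (rule DERIV_continuous_on[OF has_field_derivative_at_within[OF normal_cutoff_derivs(2)]])
       (use assms(2) in auto)
  then show "continuous_on S (test_profile'' p d)"
    unfolding test_profile''_def cutoff_error_def using w0_pos[OF assms(1)]
    by (intro continuous_intros 1 n continuous_on_w0 continuous_on_w0_slope assms)
       (auto simp: less_imp_neq[symmetric])
qed

text \<open>
  The function \<open>g\<close> of the introduction: the height at \<open>v\<close> of the graph of \<open>r \<mapsto> r\<^sup>p\<close> above its
  tangent at \<open>w\<^sub>0\<close>.
\<close>

definition convexity_gap :: "real \<Rightarrow> ((real ^ 'm) \<times> real \<Rightarrow> real) \<Rightarrow> (real ^ 'm) \<times> real \<Rightarrow> real" where
  "convexity_gap p v x = v x powr p - w0 p (snd x) powr p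
     - p * w0 p (snd x) powr (p - 1) * (v x - w0 p (snd x))"

text \<open>
  The Green identities of \<open>v\<close> in all directions, minus the one of \<open>w\<^sub>0\<close> in the normal direction. In
  the tangential directions \<open>v\<close> is kept instead of \<open>\<phi> = v - w\<^sub>0\<close>, since the one-sided bound on the
  Laplacian of the cutoff requires a positive factor.
\<close>

lemma tested_equation:
  fixes v :: "(real ^ 'm) \<times> real \<Rightarrow> real"
  assumes p: "p > 1" and n: "n > 0" and d: "d > 0" and v: "C2_on v half_space"
    and eq: "\<And>x. x \<in> half_space \<Longrightarrow> laplacian v x = v x - v x powr p"
  shows "has_bochner_integral lborel (\<lambda>x. indicator (cball 0 (exp n) \<times> {d..1 / d}) x *\<^sub>R
      (v x * (\<Sum>e\<in>Basis. tangential_cutoff'' n e (fst x)) * test_profile p d (snd x)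
       + (v x - w0 p (snd x)) * tangential_cutoff n (fst x) * cutoff_error p d (snd x)
       + tangential_cutoff n (fst x) * test_profile p d (snd x) * convexity_gap p v x)) 0"
proof -
  define K :: "((real ^ 'm) \<times> real) set" where "K = cball 0 (exp n) \<times> {d..1 / d}"
  define z where "z = (\<lambda>x :: (real ^ 'm) \<times> real. tangential_cutoff n (fst x) * test_profile p d (snd x))"
  define w where "w = (\<lambda>x :: (real ^ 'm) \<times> real. w0 p (snd x))"
  have K: "compact K" "K \<subseteq> half_space"
    using d by (auto simp: K_def half_space_def intro!: compact_Times)
  have off: "fst x \<notin> cball 0 (exp n) \<or> snd x \<notin> {d..1 / d} \<and> snd x > 0"
    if "x \<in> half_space - K" for x
    using that by (cases x) (auto simp: K_def half_space_def)
  have tc0: "tangential_cutoff n y = 0"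
    "tangential_cutoff' n e y = 0" if "y \<notin> cball 0 (exp n)" for y e :: "real ^ 'm"
    using tangential_base_eq_0[OF n that] by (simp_all add: tangential_cutoff_def tangential_cutoff'_def)
  have snd_in: "snd ` half_space \<subseteq> {0<..}" by (auto simp: half_space_def)
  note th = continuous_on_test_profile[OF p snd_in, THEN continuous_on_compose2,
      OF continuous_on_snd[OF continuous_on_id] subset_refl]
  note tc = continuous_on_tangential_cutoff[of UNIV, THEN continuous_on_compose2,
      OF continuous_on_fst[OF continuous_on_id] subset_UNIV]
  define E where "E =
        (\<lambda>e x. indicator K x *\<^sub>R (v x * (tangential_cutoff'' n e (fst x) * test_profile p d (snd x))
      - z x * partial_deriv (e, 0) (partial_deriv (e, 0) v) x))"
  define N where "N =
        (\<lambda>u x. indicator K x *\<^sub>R (u x * (tangential_cutoff n (fst x) * test_profile'' p d (snd x))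
      - z x * partial_deriv (0, 1) (partial_deriv (0, 1) u) x))"
  have E: "has_bochner_integral lborel (E e) 0" if e: "e \<in> Basis" for e
    unfolding E_def
  proof (rule green_identity[OF open_half_space K _ v, where z' =
        "\<lambda>x. tangential_cutoff' n e (fst x) * test_profile p d (snd x)"])
    show "(e, 0) \<in> Basis" using e by (simp add: Basis_prod_def)
    fix x
    show "has_dir_deriv z (e, 0) (tangential_cutoff' n e (fst x) * test_profile p d (snd x)) x"
      using DERIV_cmult_right[OF tangential_cutoff_derivs(1)[OF e]] by (simp add: z_def)
    show "has_dir_deriv (\<lambda>x. tangential_cutoff' n e (fst x) * test_profile p d (snd x)) (e, 0)
        (tangential_cutoff'' n e (fst x) * test_profile p d (snd x)) x"
      using DERIV_cmult_right[OF tangential_cutoff_derivs(2)[OF e]] by simp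
  next
    fix x assume "x \<in> half_space - K"
    from off[OF this] show "z x = 0" "tangential_cutoff' n e (fst x) * test_profile p d (snd x) = 0"
      using tc0 test_profile_eq_0[OF d] by (auto simp: z_def)
  qed (auto simp: z_def intro!: continuous_on_mult th tc)
  have N: "has_bochner_integral lborel (N u) 0" if u: "C2_on u half_space" for u
    unfolding N_def
  proof (rule green_identity[OF open_half_space K _ u, where z' =
        "\<lambda>x. tangential_cutoff n (fst x) * test_profile' p d (snd x)"])
    show "(0, 1) \<in> (Basis :: ((real ^ 'm) \<times> real) set)" by (simp add: Basis_prod_def)
    fix x :: "(real ^ 'm) \<times> real" assume "x \<in> half_space"
    then have x: "snd x > 0" by (simp add: half_space_def)
    have line: "((\<lambda>s. f (snd x + s)) has_real_derivative D) (at 0)"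
      if "(f has_real_derivative D) (at (snd x))" for f :: "real \<Rightarrow> real" and D
      using that DERIV_shift[of f D 0 "snd x"] by (simp add: add.commute)
    show "has_dir_deriv z (0, 1) (tangential_cutoff n (fst x) * test_profile' p d (snd x)) x"
      using DERIV_cmult[OF line[OF test_profile_derivs(1)[OF p x]]] by (simp add: z_def)
    show "has_dir_deriv (\<lambda>x. tangential_cutoff n (fst x) * test_profile' p d (snd x)) (0, 1)
        (tangential_cutoff n (fst x) * test_profile'' p d (snd x)) x"
      using DERIV_cmult[OF line[OF test_profile_derivs(2)[OF p x]]] by simp
  next
    fix x assume "x \<in> half_space - K"
    from off[OF this] show "z x = 0" "tangential_cutoff n (fst x) * test_profile' p d (snd x) = 0"
      using tc0 test_profile_eq_0[OF d] by (auto simp: z_def)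
  qed (auto simp: z_def intro!: continuous_on_mult th tc)
  have w: "C2_on w half_space"
    "\<And>x. x \<in> half_space \<Longrightarrow> partial_deriv (0, 1) (partial_deriv (0, 1) w) x = w x - w x powr p"
    using w0_profile_C2[OF p, of w] by (auto simp: w_def)
  have "has_bochner_integral lborel (\<lambda>x. (\<Sum>e\<in>Basis. E e x) + N v x - N w x) ((\<Sum>e\<in>(Basis :: (real ^ 'm) set). 0) + 0 - 0)"
    by (intro has_bochner_integral_diff has_bochner_integral_add has_bochner_integral_sum E N v w(1))
  moreover have "(\<Sum>e\<in>Basis. E e x) + N v x - N w x = indicator K x *\<^sub>R
      (v x * (\<Sum>e\<in>Basis. tangential_cutoff'' n e (fst x)) * test_profile p d (snd x)
       + (v x - w0 p (snd x)) * tangential_cutoff n (fst x) * cutoff_error p d (snd x)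
       + tangential_cutoff n (fst x) * test_profile p d (snd x) * convexity_gap p v x)" for x
  proof (cases "x \<in> K")
    case True
    \<comment> \<open>On \<open>K\<close> the identity is algebra: the equation replaces the sum of the tangential second
    derivatives, after which the normal ones cancel against those in \<open>N\<close>.\<close>
    define P where "P = (\<lambda>i. partial_deriv i (partial_deriv i v) x)"
    define T where "T = (\<Sum>e\<in>Basis. tangential_cutoff'' n e (fst x))"
    have x: "x \<in> half_space" using True K by blast
    have "(\<Sum>e\<in>Basis. P (e, 0)) + P (0, 1) = v x - v x powr p"
      using eq[OF x] unfolding laplacian_def P_def by (simp add: sum_Basis_prod_real)
    then have lap: "(\<Sum>e\<in>Basis. P (e, 0)) = v x - v x powr p - P (0, 1)" by simp
    have "(\<Sum>e\<in>Basis. E e x) =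
          (\<Sum>e\<in>Basis. v x * test_profile p d (snd x) * tangential_cutoff'' n e (fst x) - z x * P (e, 0))"
      using True by (intro sum.cong) (auto simp: E_def P_def)
    also have "\<dots> = v x * test_profile p d (snd x) * T - z x * (v x - v x powr p - P (0, 1))"
      by (simp only: sum_subtractf sum_distrib_left[symmetric] lap T_def)
    finally have "(\<Sum>e\<in>Basis. E e x) =
          v x * test_profile p d (snd x) * T - z x * (v x - v x powr p - P (0, 1))" .
    moreover have "N v x = v x * (tangential_cutoff n (fst x) * test_profile'' p d (snd x)) - z x * P (0, 1)"
      using True by (simp add: N_def P_def)
    moreover have "N w x = w0 p (snd x) * (tangential_cutoff n (fst x) * test_profile'' p d (snd x))
        - z x * (w0 p (snd x) - w0 p (snd x) powr p)"
      using True unfolding N_def w(2)[OF x] by (simp add: w_def)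
    ultimately show ?thesis
      using True by (simp add: T_def[symmetric] z_def convexity_gap_def test_profile''_def algebra_simps)
  qed (simp add: E_def N_def)
  ultimately show ?thesis by (simp add: K_def)
qed

section \<open>Error estimates\<close>

text \<open>
  Near the boundary this is uniform continuity of \<open>v - w\<^sub>0\<close> on compact sets together with the
  boundary condition; far from it, both functions decay uniformly.
\<close>

lemma difference_small_outside_strip:
  fixes v :: "(real ^ 'm) \<times> real \<Rightarrow> real"
  assumes p: "p > 1" and v: "dirichlet_solution p v" and eps: "eps > 0"
  obtains a A where "0 < a" "a < A"
    "\<And>(y :: real ^ 'm) t. norm y \<le> R \<Longrightarrow> t > 0 \<Longrightarrow> t \<notin> {a..A} \<Longrightarrow> \<bar>v (y, t) - w0 p t\<bar> \<le> eps"
proof -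
  define phi where "phi = (\<lambda>x. v x - w0 p (snd x))"
  define C :: "((real ^ 'm) \<times> real) set" where "C = cball 0 R \<times> {0..1}"
  have C: "compact C" "C \<subseteq> closure half_space"
    by (auto simp: C_def closure_half_space intro!: compact_Times)
  have "continuous_on C v"
    using v C(2) by (auto simp: dirichlet_solution_def intro: continuous_on_subset)
  then have "continuous_on C phi"
    unfolding phi_def
    by (intro continuous_intros continuous_on_compose2[OF continuous_on_w0[OF p, of UNIV]]) auto
  then have "uniformly_continuous_on C phi" using C(1) by (rule compact_uniformly_continuous)
  then obtain a0 where a0: "a0 > 0"
    "\<And>x x'. x \<in> C \<Longrightarrow> x' \<in> C \<Longrightarrow> dist x' x < a0 \<Longrightarrow> dist (phi x') (phi x) < eps"
    using eps unfolding uniformly_continuous_on_def by meson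
  define a where "a = min a0 1"
  have near: "\<bar>v (y, t) - w0 p t\<bar> \<le> eps" if "norm y \<le> R" "0 < t" "t < a" for y :: "real ^ 'm" and t
  proof -
    have "dist (phi (y, t)) (phi (y, 0)) < eps"
      using that by (intro a0(2)) (auto simp: C_def a_def dist_Pair_Pair)
    moreover have "phi (y, 0) = 0"
      using v by (auto simp: phi_def dirichlet_solution_def frontier_half_space w0_0)
    ultimately show ?thesis by (simp add: phi_def dist_real_def)
  qed
  have "\<forall>\<^sub>F t in at_top. \<forall>y\<in>UNIV. dist (v (y, t)) 0 < eps / 2"
    using v eps by (intro uniform_limitD) (auto simp: dirichlet_solution_def)
  moreover have "\<forall>\<^sub>F t in at_top. dist (w0 p t) 0 < eps / 2"
    using eps by (intro tendstoD[OF w0_tendsto_0[OF p]]) auto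
  ultimately have "\<forall>\<^sub>F t in at_top. \<forall>y. \<bar>v (y, t) - w0 p t\<bar> \<le> eps"
  proof eventually_elim
    case (elim t)
    show ?case
    proof
      fix y :: "real ^ 'm"
      have "dist (v (y, t)) 0 < eps / 2" using elim(1) by blast
      with elim(2) show "\<bar>v (y, t) - w0 p t\<bar> \<le> eps" unfolding dist_real_def by linarith
    qed
  qed
  then obtain A0 where A0: "\<And>t (y :: real ^ 'm). t \<ge> A0 \<Longrightarrow> \<bar>v (y, t) - w0 p t\<bar> \<le> eps"
    unfolding eventually_at_top_linorder by blast
  show ?thesis
  proof (rule that[of a "max A0 (a + 1)"])
    show "0 < a" using a0 by (simp add: a_def)
    fix y :: "real ^ 'm" and t :: real assume "norm y \<le> R" "t > 0" "t \<notin> {a..max A0 (a + 1)}"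
    then show "\<bar>v (y, t) - w0 p t\<bar> \<le> eps" using near[of y t] A0[of t y] by auto
  qed auto
qed

text \<open>
  The factor \<open>\<alpha>\<close> is multiplied by \<open>\<integral> \<psi> \<le> w\<^sub>0(0)\<close>, the factor \<open>\<beta>\<close> by
  \<open>\<integral> d (1 + 1/t\<^sup>2) dt \<le> 2\<close> uniformly in \<open>d\<close>, and only the factor \<open>\<gamma>\<close> of the fixed strip \<open>[a, A]\<close>
  comes with a power of \<open>d\<close>.
\<close>

lemma remainder_integral:
  fixes b :: "'a::euclidean_space \<Rightarrow> real"
  assumes p: "p > 1" and d: "0 < d" "d \<le> 1" and aA: "0 < a" "a < A"
    and nn: "0 \<le> \<alpha>" "0 \<le> \<beta>" "0 \<le> \<gamma>"
    and b: "integrable lborel b" "0 \<le> (LINT y|lborel. b y)"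
  obtains I where "has_bochner_integral lborel
      (\<lambda>x. b (fst x) * (\<alpha> * (w0_slope p (snd x) * indicator {d..1 / d} (snd x)))
        + indicator (cball (0::'a) R) (fst x) * (\<beta> * (d * ((1 + 1 / (snd x)\<^sup>2) * indicator {d..1 / d} (snd x)))
             + \<gamma> * (d * indicator {a..A} (snd x)))) I"
    "I \<le> \<alpha> * (LINT y|lborel. b y) * c_const p
       + measure lborel (cball (0::'a) R) * (2 * \<beta> + \<gamma> * (A - a) * d)"
proof -
  have dd: "d \<le> 1 / d" using d by (simp add: field_simps) (metis mult_le_one less_imp_le)
  have "has_bochner_integral lborel (\<lambda>t. w0_slope p t * indicator {d..1 / d} t) (- w0 p (1 / d) - - w0 p d)"
    using DERIV_minus[OF DERIV_w0[OF p]]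
    by (intro has_bochner_integral_FTC_Icc_real dd) (auto intro: DERIV_isCont[OF DERIV_w0_slope[OF p]])
  then have s: "has_bochner_integral lborel (\<lambda>t. w0_slope p t * indicator {d..1 / d} t) (w0 p d - w0 p (1 / d))"
    by simp
  have "has_bochner_integral lborel (\<lambda>t. (1 + 1 / t\<^sup>2) * indicator {d..1 / d} t)
      ((1 / d - 1 / (1 / d)) - (d - 1 / d))"
  proof (intro has_bochner_integral_FTC_Icc_real dd)
    fix t assume "d \<le> t"
    then have "t \<noteq> 0" using d by simp
    then show "((\<lambda>t. t - 1 / t) has_real_derivative 1 + 1 / t\<^sup>2) (at t)"
      by - (rule derivative_eq_intros refl | simp add: power2_eq_square)+
    from \<open>t \<noteq> 0\<close> show "isCont (\<lambda>t. 1 + 1 / t\<^sup>2) t" by (intro continuous_intros) auto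
  qed
  then have q: "has_bochner_integral lborel (\<lambda>t. (1 + 1 / t\<^sup>2) * indicator {d..1 / d} t) (2 * (1 / d - d))"
    by (simp add: algebra_simps)
  have i: "has_bochner_integral lborel (\<lambda>t. indicator {a..A} t) (A - a)"
    using aA by (simp add: has_bochner_integral_iff)
  have c: "has_bochner_integral lborel (indicator (cball (0::'a) R)) (measure lborel (cball (0::'a) R))"
    using emeasure_lborel_cball_finite[of "0::'a" R] by (intro has_bochner_integral_real_indicator) auto
  define J where "J = \<beta> * (d * (2 * (1 / d - d))) + \<gamma> * (d * (A - a))"
  define V where "V = measure lborel (cball (0::'a) R)"
  define I where "I = (LINT y|lborel. b y) * (\<alpha> * (w0 p d - w0 p (1 / d))) + V * J"
  have s': "has_bochner_integral lborel (\<lambda>t. \<alpha> * (w0_slope p t * indicator {d..1 / d} t)) (\<alpha> * (w0 p d - w0 p (1 / d)))"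
    by (intro has_bochner_integral_mult_right s)
  have J: "has_bochner_integral lborel (\<lambda>t. \<beta> * (d * ((1 + 1 / t\<^sup>2) * indicator {d..1 / d} t))
      + \<gamma> * (d * indicator {a..A} t)) J"
    unfolding J_def by (intro has_bochner_integral_add has_bochner_integral_mult_right q i)
  have I: "has_bochner_integral lborel
      (\<lambda>x. b (fst x) * (\<alpha> * (w0_slope p (snd x) * indicator {d..1 / d} (snd x)))
        + indicator (cball (0::'a) R) (fst x) * (\<beta> * (d * ((1 + 1 / (snd x)\<^sup>2) * indicator {d..1 / d} (snd x)))
             + \<gamma> * (d * indicator {a..A} (snd x)))) I"
    unfolding I_def V_def
    by (intro has_bochner_integral_add has_bochner_integral_product[OF _ s']
        has_bochner_integral_product[OF c J]) (simp add: has_bochner_integral_iff b)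
  have "\<alpha> * (w0 p d - w0 p (1 / d)) \<le> \<alpha> * c_const p"
    using w0_le[OF p, of d] w0_pos[OF p, of "1 / d"] nn by (intro mult_left_mono) auto
  then have 1: "(LINT y|lborel. b y) * (\<alpha> * (w0 p d - w0 p (1 / d))) \<le> (LINT y|lborel. b y) * (\<alpha> * c_const p)"
    using b(2) by (rule mult_left_mono)
  have "d * (2 * (1 / d - d)) \<le> 2" using d by (simp add: algebra_simps)
  then have "\<beta> * (d * (2 * (1 / d - d))) \<le> \<beta> * 2" using nn(2) by (rule mult_left_mono)
  then have "V * J \<le> V * (2 * \<beta> + \<gamma> * (A - a) * d)"
    by (intro mult_left_mono) (auto simp: J_def V_def algebra_simps)
  with 1 have "I \<le> \<alpha> * (LINT y|lborel. b y) * c_const p + V * (2 * \<beta> + \<gamma> * (A - a) * d)"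
    unfolding I_def by (simp add: mult.assoc mult.left_commute)
  with I show ?thesis using that unfolding V_def by blast
qed

text \<open>
  Pointwise lower bound for the two terms of the tested equation that have no sign. It has the shape
  that is integrated in \<open>remainder_integral\<close>.
\<close>

lemma tested_integrand_ge:
  fixes y :: "'a::euclidean_space"
  assumes dim: "DIM('a) \<le> 2" and p: "p > 1" and n: "n > 0" and d: "d > 0" and t: "t > 0"
    and u: "0 < u" "u \<le> M" and eps: "0 \<le> eps" and a: "0 < a"
    and phi: "\<bar>u - w0 p t\<bar> \<le> eps + (M + c_const p) * indicator {a..A} t"
  shows "u * (\<Sum>e\<in>Basis. tangential_cutoff'' n e y) * test_profile p d t + (u - w0 p t) * tangential_cutoff n y * cutoff_error p d t \<ge>
    - (1 / (1 + y \<bullet> y)\<^sup>2 * (12 * M / n * w0_slope p t)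
       + (eps * error_const p * (d * (1 + 1 / t\<^sup>2))
          + (M + c_const p) * error_const p * (1 + 1 / a\<^sup>2) * (d * indicator {a..A} t)))"
proof -
  define b where "b = 1 / (1 + y \<bullet> y)\<^sup>2"
  define C where "C = error_const p"
  define c where "c = c_const p"
  define rr where "rr = 1 + 1 / t\<^sup>2"
  define S where "S = (\<Sum>e\<in>Basis. tangential_cutoff'' n e y)"
  have pos: "0 \<le> b" "0 < C" "0 < c" "0 < M"
    using error_const_pos[OF p] c_const_pos[OF p] u by (auto simp: b_def C_def c_def)
  have th: "0 \<le> test_profile p d t" "test_profile p d t \<le> w0_slope p t"
    using test_profile_bounds[OF p d t] .
  have tc: "0 \<le> tangential_cutoff n y" "tangential_cutoff n y \<le> 1"
    using tangential_cutoff_bounds[of n y] n by auto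
  have "- (12 / n * b) \<le> S"
    unfolding S_def b_def using tangential_cutoff_laplacian_ge[OF dim n, of y] by simp
  then have "- (12 / n * b) * (u * test_profile p d t) \<le> S * (u * test_profile p d t)"
    using u th by (intro mult_right_mono) auto
  moreover have "(12 / n * b) * (u * test_profile p d t) \<le> (12 / n * b) * (M * w0_slope p t)"
    using u th n pos by (intro mult_left_mono mult_mono) auto
  ultimately have 1: "u * S * test_profile p d t \<ge> - (b * (12 * M / n * w0_slope p t))"
    by (simp add: algebra_simps)
  have E: "\<bar>cutoff_error p d t\<bar> \<le> C * (d * rr)"
    using cutoff_error_bound[OF p d t] by (simp add: C_def rr_def)
  have rA: "indicator {a..A} t * rr \<le> indicator {a..A} t * (1 + 1 / a\<^sup>2)"
  proof (cases "t \<in> {a..A}")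
    case True
    then have "1 / t\<^sup>2 \<le> 1 / a\<^sup>2" using a t by (intro divide_left_mono power_mono) auto
    with True show ?thesis by (simp add: rr_def)
  qed simp
  have "\<bar>(u - w0 p t) * tangential_cutoff n y * cutoff_error p d t\<bar> =
        tangential_cutoff n y * (\<bar>u - w0 p t\<bar> * \<bar>cutoff_error p d t\<bar>)"
    using tc by (simp add: abs_mult)
  also have "\<dots> \<le> 1 * ((eps + (M + c) * indicator {a..A} t) * (C * (d * rr)))"
    using tc phi E eps pos by (intro mult_mono) (auto simp: c_def)
  also have "\<dots> = eps * C * (d * rr) + (M + c) * C * d * (indicator {a..A} t * rr)"
    by (simp add: algebra_simps)
  also have "\<dots> \<le> eps * C * (d * rr) + (M + c) * C * d * (indicator {a..A} t * (1 + 1 / a\<^sup>2))"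
    using pos d by (intro add_left_mono mult_left_mono[OF rA]) auto
  also have "\<dots> = eps * C * (d * rr) + (M + c) * C * (1 + 1 / a\<^sup>2) * (d * indicator {a..A} t)"
    by (simp add: algebra_simps)
  finally have "(u - w0 p t) * tangential_cutoff n y * cutoff_error p d t \<ge>
      - (eps * C * (d * rr) + (M + c) * C * (1 + 1 / a\<^sup>2) * (d * indicator {a..A} t))"
    by (simp add: abs_le_iff)
  with 1 show ?thesis
    unfolding b_def[symmetric] C_def[symmetric] c_def[symmetric] rr_def[symmetric] S_def[symmetric]
    by linarith
qed

section \<open>Uniqueness\<close>

lemma convexity_gap_nonneg:
  assumes "p > 1" "v x > 0"
  shows "0 \<le> convexity_gap p v x" "v x \<noteq> w0 p (snd x) \<Longrightarrow> 0 < convexity_gap p v x"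
  using tangent_above_powr[OF assms(1,2) w0_pos[OF assms(1)], of "snd x"]
  by (cases "v x = w0 p (snd x)"; simp add: convexity_gap_def)+

text \<open>
  If \<open>v \<noteq> w\<^sub>0\<close> at \<open>x0\<close>, then \<open>\<psi> g\<close> is bounded below on a ball around \<open>x0\<close>, so the third term of the
  tested equation contributes a fixed positive amount \<open>c2\<close>, whereas the other two contribute at least
  \<open>- 3/4 c2\<close> for a suitable choice of parameters. The order of the choices matters: first \<open>n\<close>, then
  \<open>eps\<close> depending on the volume \<open>V\<close> of the tangential support, then the strip \<open>[a, A]\<close>, and \<open>d\<close> last.
\<close>

lemma solution_is_profile:
  fixes v :: "(real ^ 'm) \<times> real \<Rightarrow> real"
  assumes dim: "DIM(real ^ 'm) \<le> 2" and p: "p > 1" and v: "positive_bounded_solution p v"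
    and x0: "x0 \<in> half_space"
  shows "v x0 = w0 p (snd x0)"
proof (rule ccontr)
  assume ne: "v x0 \<noteq> w0 p (snd x0)"
  have sol: "dirichlet_solution p v" and pos: "\<And>x. x \<in> half_space \<Longrightarrow> v x > 0"
    using v by (auto simp: positive_bounded_solution_def)
  have C2: "C2_on v half_space" using sol by (simp add: dirichlet_solution_def)
  have cv: "continuous_on half_space v"
    using C2 by (auto simp: C2_on_def C1_on_def intro: differentiable_imp_continuous_on)
  have lap: "laplacian v x = v x - v x powr p" if x: "x \<in> half_space" for x
  proof -
    have "- laplacian v x + v x = \<bar>v x\<bar> powr (p - 1) * v x"
      using sol x by (simp add: dirichlet_solution_def)
    also have "\<dots> = v x powr p" using powr_add[of "v x" "p - 1" 1] pos[OF x] by simp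
    finally show ?thesis by simp
  qed
  obtain M0 where M0: "\<And>x. x \<in> half_space \<Longrightarrow> \<bar>v x\<bar> \<le> M0"
    using v unfolding positive_bounded_solution_def bounded_real by blast
  define M where "M = max M0 1"
  have M: "M > 0" "\<And>x. x \<in> half_space \<Longrightarrow> v x \<le> M"
    using M0 by (auto simp: M_def le_max_iff_disj abs_le_iff)
  define c where "c = c_const p"
  define C where "C = error_const p"
  have c: "c > 0" using c_const_pos[OF p] by (simp add: c_def)
  have C: "C > 0" unfolding C_def by (rule error_const_pos[OF p])
  define b where "b = (\<lambda>y::real ^ 'm. 1 / (1 + y \<bullet> y)\<^sup>2)"
  have b: "integrable lborel b" "\<And>y. 0 \<le> b y"
    unfolding b_def by (auto intro: integrable_inverse_square[OF dim])
  define Ib where "Ib = (LINT y|lborel. b y)"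
  have Ib: "0 \<le> Ib" unfolding Ib_def using b(2) by simp
  define h where "h = (\<lambda>x. w0_slope p (snd x) * convexity_gap p v x)"
  have x0p: "snd x0 > 0" using x0 by (simp add: half_space_def)
  have h0: "h x0 > 0"
    using convexity_gap_nonneg(2)[of p v x0] p pos[OF x0] ne w0_slope_pos[OF p x0p] by (simp add: h_def)
  have ch: "continuous_on half_space h"
    unfolding h_def convexity_gap_def
    using pos w0_pos[OF p]
    by (intro continuous_intros cv continuous_on_compose2[OF continuous_on_w0[OF p, of UNIV]]
        continuous_on_compose2[OF continuous_on_w0_slope[OF p, of UNIV]])
       (auto simp: less_imp_neq[symmetric])
  have "open (half_space \<inter> h -` {h x0 / 2<..})"
    by (rule continuous_open_preimage[OF ch open_half_space]) simp
  moreover have "x0 \<in> half_space \<inter> h -` {h x0 / 2<..}" using x0 h0 by simp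
  ultimately obtain r0 where r0: "r0 > 0" "ball x0 r0 \<subseteq> half_space \<inter> h -` {h x0 / 2<..}"
    by (meson open_contains_ball)
  define r where "r = min r0 (snd x0 / 2)"
  have r: "r > 0" "r \<le> snd x0 / 2" using r0 x0p by (auto simp: r_def)
  define B where "B = ball x0 r"
  have B: "x \<in> half_space" "h x \<ge> h x0 / 2" "norm (fst x) \<le> norm (fst x0) + r"
    "snd x \<ge> snd x0 / 2" "snd x \<le> 2 * snd x0" if "x \<in> B" for x
  proof -
    have "x \<in> ball x0 r0" using that by (auto simp: B_def r_def)
    then show "x \<in> half_space" "h x \<ge> h x0 / 2" using r0(2) by auto
    have d: "dist x0 x < r" using that by (simp add: B_def)
    have "dist (fst x0) (fst x) < r" "dist (snd x0) (snd x) < r"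
      using d dist_fst_le[of x0 x] dist_snd_le[of x0 x] by auto
    then show "norm (fst x) \<le> norm (fst x0) + r" "snd x \<ge> snd x0 / 2" "snd x \<le> 2 * snd x0"
      using r norm_triangle_ineq2[of "fst x" "fst x0"]
      by (auto simp: dist_norm norm_minus_commute abs_less_iff)
  qed
  \<comment> \<open>Half of \<open>h x0\<close> remains on the ball, and each of the two cutoffs is at least \<open>1/8\<close> there.\<close>
  define c2 where "c2 = h x0 / 128 * measure lborel B"
  have c2: "c2 > 0" unfolding c2_def B_def using h0 r(1)
    by (intro mult_pos_pos) (auto simp: content_ball_pos)
  define \<rho>1 where "\<rho>1 = (norm (fst x0) + r)\<^sup>2"
  define n where "n = Max {1, 2 * ln (1 + \<rho>1), 48 * M * Ib * c / c2}"
  have n: "n > 0" "n \<ge> 2 * ln (1 + \<rho>1)" "n \<ge> 48 * M * Ib * c / c2"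
    by (auto simp: n_def)
  define V where "V = measure lborel (cball (0::real ^ 'm) (exp n))"
  have V: "V \<ge> 0" by (simp add: V_def)
  define eps where "eps = c2 / (8 * C * (V + 1))"
  have eps: "eps > 0" using c2 C V by (simp add: eps_def)
  obtain a A where aA: "0 < a" "a < A"
    and strip: "\<And>(y :: real ^ 'm) t. norm y \<le> exp n \<Longrightarrow> t > 0 \<Longrightarrow> t \<notin> {a..A} \<Longrightarrow> \<bar>v (y, t) - w0 p t\<bar> \<le> eps"
    using difference_small_outside_strip[OF p sol eps, where R = "exp n"] by blast
  define g where "g = (M + c) * C * (1 + 1 / a\<^sup>2)"
  have g: "g \<ge> 0" unfolding g_def using M c C by auto
  define \<rho>2 where "\<rho>2 = 2 * snd x0 + 2 / snd x0"
  have \<rho>2: "\<rho>2 > 0" using x0p by (auto simp: \<rho>2_def intro: add_pos_pos)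
  define D where "D = 4 * (g * (A - a) * V + 1)"
  have D: "D > 0" using g aA V by (auto simp: D_def intro!: add_nonneg_pos)
  define d where "d = Min {1, 1 / (2 * \<rho>2), c2 / D}"
  have d: "d > 0" "d \<le> 1" "d \<le> 1 / (2 * \<rho>2)" "d \<le> c2 / D"
    using \<rho>2 D c2 by (auto simp: d_def)
  define K :: "((real ^ 'm) \<times> real) set" where "K = cball 0 (exp n) \<times> {d..1 / d}"
  define F where "F = (\<lambda>x. indicator K x *\<^sub>R
      (v x * (\<Sum>e\<in>Basis. tangential_cutoff'' n e (fst x)) * test_profile p d (snd x)
       + (v x - w0 p (snd x)) * tangential_cutoff n (fst x) * cutoff_error p d (snd x)
       + tangential_cutoff n (fst x) * test_profile p d (snd x) * convexity_gap p v x))"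
  have F: "has_bochner_integral lborel F 0"
    unfolding F_def K_def by (rule tested_equation[OF p n(1) d(1) C2 lap])
  define U where "U = (\<lambda>x :: (real ^ 'm) \<times> real.
      b (fst x) * (12 * M / n * (w0_slope p (snd x) * indicator {d..1 / d} (snd x)))
      + indicator (cball 0 (exp n)) (fst x) *
         (eps * C * (d * ((1 + 1 / (snd x)\<^sup>2) * indicator {d..1 / d} (snd x)))
          + g * (d * indicator {a..A} (snd x))))"
  obtain I where I: "has_bochner_integral lborel U I"
    "I \<le> 12 * M / n * Ib * c + V * (2 * (eps * C) + g * (A - a) * d)"
    using remainder_integral[OF p d(1,2) aA, of "12 * M / n" "eps * C" g b "exp n"]
      M n eps C g b Ib unfolding U_def Ib_def V_def c_def by (auto simp: less_imp_le)
  have U_nonneg: "0 \<le> U x" for x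
  proof (cases "snd x > 0")
    case True
    then show ?thesis
      unfolding U_def using M n eps C g b(2) d w0_slope_bounds(1)[OF p, of "snd x"]
      by (intro add_nonneg_nonneg mult_nonneg_nonneg) (auto simp: less_imp_le)
  next
    case False
    then have "snd x \<notin> {d..1 / d}" "snd x \<notin> {a..A}" using d aA by auto
    then show ?thesis by (simp add: U_def)
  qed
  have cuts: "tangential_cutoff n (fst x) \<ge> 1 / 8" "normal_cutoff d (snd x) \<ge> 1 / 8" if x: "x \<in> B" for x
  proof -
    have "fst x \<bullet> fst x \<le> \<rho>1"
      unfolding \<rho>1_def power2_norm_eq_inner[symmetric] using B(3)[OF x] by (intro power_mono) auto
    then have "ln (1 + fst x \<bullet> fst x) \<le> ln (1 + \<rho>1)"
      using one_plus_inner_pos[of "fst x"] by simp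
    then have "ln (1 + fst x \<bullet> fst x) / n \<le> 1 / 2" using n by (simp add: field_simps)
    then have "1 / 2 \<le> tangential_base n (fst x)" unfolding tangential_base_def
      by (intro max.coboundedI2) linarith
    then have "(1 / 2) ^ 3 \<le> tangential_base n (fst x) ^ 3" by (intro power_mono) auto
    then show "tangential_cutoff n (fst x) \<ge> 1 / 8" by (simp add: tangential_cutoff_def power_divide)
    have "1 / snd x \<le> 1 / (snd x0 / 2)" using B(4)[OF x] x0p by (intro divide_left_mono) auto
    then have "snd x + 1 / snd x \<le> \<rho>2" using B(5)[OF x] by (simp add: \<rho>2_def)
    then have "d * (snd x + 1 / snd x) \<le> d * \<rho>2" using d by (intro mult_left_mono) auto
    also have "\<dots> \<le> 1 / 2" using d(3) \<rho>2 by (simp add: field_simps)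
    finally have "1 / 2 \<le> normal_base d (snd x)" unfolding normal_base_def
      by (intro max.coboundedI2) linarith
    then have "(1 / 2) ^ 3 \<le> normal_base d (snd x) ^ 3" by (intro power_mono) auto
    then show "normal_cutoff d (snd x) \<ge> 1 / 8" by (simp add: normal_cutoff_def power_divide)
  qed
  have BK: "x \<in> K" if x: "x \<in> B" for x
  proof -
    have "snd x > 0" using B(1)[OF x] by (simp add: half_space_def)
    then have "snd x \<in> {d..1 / d}"
      using cuts(2)[OF x] normal_base_eq_0[OF d(1), of "snd x"] by (force simp: normal_cutoff_def)
    moreover have "fst x \<in> cball 0 (exp n)"
      using cuts(1)[OF x] tangential_base_eq_0[OF n(1), of "fst x"]
        by (force simp: tangential_cutoff_def)
    ultimately show ?thesis by (simp add: K_def mem_Times_iff)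
  qed
  \<comment> \<open>The tested integrand dominates its contribution on the ball minus the remainder.\<close>
  have lower: "h x0 / 128 * indicator B x - U x \<le> F x" for x
  proof (cases "x \<in> K")
    case True
    define y where "y = fst x"
    define t where "t = snd x"
    have x: "x = (y, t)" by (simp add: y_def t_def)
    have yt: "norm y \<le> exp n" "t \<in> {d..1 / d}" "t > 0"
      using True d by (auto simp: x K_def)
    have xh: "x \<in> half_space" using yt by (simp add: x half_space_def)
    define S where "S = (\<Sum>e\<in>Basis. tangential_cutoff'' n e y)"
    have vM: "0 < v x" "v x \<le> M" using pos[OF xh] M(2)[OF xh] .
    have "\<bar>v x - w0 p t\<bar> \<le> eps + (M + c) * indicator {a..A} t"
    proof (cases "t \<in> {a..A}")
      case True
      then show ?thesis
        using vM w0_pos[OF p, of t] w0_le[OF p, of t] eps by (simp add: abs_le_iff c_def)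
    next
      case False
      then show ?thesis using strip[OF yt(1,3)] by (simp add: x)
    qed
    then have 12: "v x * S * test_profile p d t + (v x - w0 p t) * tangential_cutoff n y * cutoff_error p d t \<ge>
        - (b y * (12 * M / n * w0_slope p t)
           + (eps * C * (d * (1 + 1 / t\<^sup>2)) + g * (d * indicator {a..A} t)))"
      using tested_integrand_ge[OF dim p n(1) d(1) yt(3) vM _ aA(1)] eps
      unfolding S_def b_def C_def g_def c_def by simp
    have gap_ge_0: "0 \<le> convexity_gap p v x" using convexity_gap_nonneg(1)[of p v x] p vM by simp
    have 3: "h x0 / 128 * indicator B x \<le> tangential_cutoff n y * test_profile p d t * convexity_gap p v x"
    proof (cases "x \<in> B")
      case True
      have "1 / 8 * (1 / 8) * (h x0 / 2) \<le> tangential_cutoff n y * normal_cutoff d t * h x"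
        using cuts[OF True] B(2)[OF True] h0 unfolding y_def t_def
        by (intro mult_mono) auto
      then show ?thesis using True by (simp add: h_def test_profile_def t_def algebra_simps)
    next
      case False
      then show ?thesis using tangential_cutoff_bounds(1)[of n y] test_profile_bounds(1)[OF p d(1) yt(3)] gap_ge_0 by simp
    qed
    have "U x =
          b y * (12 * M / n * w0_slope p t) + (eps * C * (d * (1 + 1 / t\<^sup>2)) + g * (d * indicator {a..A} t))"
      using yt by (simp add: U_def x)
    moreover have "F x =
          v x * S * test_profile p d t + (v x - w0 p t) * tangential_cutoff n y * cutoff_error p d t
        + tangential_cutoff n y * test_profile p d t * convexity_gap p v x"
      using True by (simp add: F_def S_def y_def t_def)
    ultimately show ?thesis using 12 3 by linarith
  next
    case False
    then have "x \<notin> B" using BK by blast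
    then show ?thesis using U_nonneg[of x] False by (simp add: F_def)
  qed
  have "has_bochner_integral lborel (\<lambda>x. h x0 / 128 * indicator B x - U x) (c2 - I)"
    unfolding c2_def
    by (intro has_bochner_integral_diff has_bochner_integral_mult_right I(1))
       (use emeasure_lborel_ball_finite[of x0 r] in \<open>auto simp: B_def intro: has_bochner_integral_real_indicator\<close>)
  then have "c2 - I \<le> 0"
    using integral_mono[of lborel "\<lambda>x. h x0 / 128 * indicator B x - U x" F] F lower
    by (simp add: has_bochner_integral_iff)
  moreover have "I \<le> 3 / 4 * c2"
  proof -
    have 1: "12 * M / n * Ib * c \<le> c2 / 4"
      using n c2 by (simp add: field_simps)
    have "eps * C = c2 / (8 * (V + 1))" using C by (simp add: eps_def)
    then have 2: "V * (2 * (eps * C)) \<le> c2 / 4"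
      using V c2 mult_pos_pos[OF C eps] by (simp add: field_simps)
    have "g * (A - a) * V * d \<le> (g * (A - a) * V + 1) * d" using d by (simp add: algebra_simps)
    also have "\<dots> = D * d / 4" by (simp add: D_def)
    also have "\<dots> \<le> c2 / 4" using d(4) D by (simp add: field_simps)
    finally have 3: "V * (g * (A - a) * d) \<le> c2 / 4" by (simp add: mult.commute mult.left_commute)
    show ?thesis using I(2) 1 2 3 unfolding distrib_left by linarith
  qed
  ultimately show False using c2 by simp
qed

theorem theorem1p1:
  fixes p :: real and v :: "(real ^ 'm) \<times> real \<Rightarrow> real"
  assumes "DIM((real ^ 'm) \<times> real) \<in> {2, 3}" and "p > 1"
  shows "positive_bounded_solution p v \<longleftrightarrow> (\<forall>x\<in>closure half_space. v x = w0 p (snd x))"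
proof
  assume v: "positive_bounded_solution p v"
  have dim: "DIM(real ^ 'm) \<le> 2" using assms(1) by auto
  show "\<forall>x\<in>closure half_space. v x = w0 p (snd x)"
  proof
    fix x :: "(real ^ 'm) \<times> real" assume "x \<in> closure half_space"
    then consider "x \<in> half_space" | "x \<in> frontier half_space"
      using closure_Un_frontier by blast
    then show "v x = w0 p (snd x)"
    proof cases
      case 1
      then show ?thesis by (rule solution_is_profile[OF dim assms(2) v])
    next
      case 2
      then have "snd x = 0" "v x = c_const p"
        using v
          by (auto simp only: positive_bounded_solution_def dirichlet_solution_def frontier_half_space mem_Collect_eq)
      then show ?thesis by (simp add: w0_0)
    qed
  qed
qed (use w0_is_solution[OF assms(2)] in blast)

end
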